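(* Let $d = 1$ and let $n \geq 2$ be an even integer. Then opinion 1 wins in the majority rule model $(\eta_t)_{t \geq 0}$ on $\mathbb{Z}$ with hyperedges of size $n$; that is, starting from any initial configuration $\eta_0 \subset \mathbb{Z}$ for which there are infinitely many hyperedges $h_x = \{x, x+1, \ldots, x+n-1\}$, $x \in \mathbb{Z}$, with a majority of type 1 vertices (more than $n/2$ vertices in state 1), $$P(\eta_t(x) = 0) \to 0 \quad \text{as } t \to \infty, \quad \text{for all } x \in \mathbb{Z}.$$
   Context: The majority rule model on $\mathbb{Z}$ with parameter $n > 1$ is the continuous-time Markov process whose state at time $t$ is a configuration $\eta_t$, viewed either as a function $\mathbb{Z} \to \{0,1\}$ (where $\eta_t(x)$ is the opinion/type/state of vertex $x$) or as the subset of vertices with opinion 1. The hyperedges are the sets $h_x = \{x, x+1, \ldots, x+n-1\}$, $x \in \mathbb{Z}$. The process is constructed from independent rate one Poisson processes, one attached to each hyperedge: at each arrival time $t$ of the Poisson process attached to $h_x$, all vertices of $h_x$ become of type 0 if $\operatorname{card}(\eta_{t-} \cap h_x) < n/2$, and all vertices of $h_x$ become of type 1 if $\operatorname{card}(\eta_{t-} \cap h_x) \geq n/2$ (so ties are resolved in favor of type 1). Equivalently, its generator is $$Lf(\eta) = \sum_{x} \mathbf{1}\{\operatorname{card}(\eta \cap h_x) < n/2\}\,[f(\eta \setminus h_x) - f(\eta)] + \sum_{x} \mathbf{1}\{\operatorname{card}(\eta \cap h_x) \geq n/2\}\,[f(\eta \cup h_x) - f(\eta)].$$ *)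

theory Defs
  imports "HOL-Probability.Probability"
begin

section \<open>Poisson processes\<close>

text \<open>
  Time is \<^term>\<open>{0..} :: real set\<close>; values of a process at negative times are irrelevant.
  The counting process is almost surely nondecreasing, so the truncated subtraction on
  \<^typ>\<open>nat\<close> yields the genuine increments almost surely.
\<close>

locale poisson_process = prob_space M
  for M :: "'w measure" and rate :: real and N :: "real \<Rightarrow> 'w \<Rightarrow> nat" +
  assumes rate_pos: "0 < rate"
    and measurable_count: "\<And>t. 0 \<le> t \<Longrightarrow> N t \<in> measurable M (count_space UNIV)"
    and count_0: "AE \<omega> in M. N 0 \<omega> = 0"
    and count_mono: "AE \<omega> in M. mono_on {0..} (\<lambda>t. N t \<omega>)"
    and count_right_continuous:
      "AE \<omega> in M. \<forall>t\<ge>0. eventually (\<lambda>s. N s \<omega> = N t \<omega>) (at_right t)"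
    and increments_poisson: "\<And>s t. 0 \<le> s \<Longrightarrow> s < t \<Longrightarrow>
      distr M (count_space UNIV) (\<lambda>\<omega>. N t \<omega> - N s \<omega>) =
        measure_pmf (poisson_pmf (rate * (t - s)))"
    and increments_indep: "\<And>t :: nat \<Rightarrow> real. 0 \<le> t 0 \<Longrightarrow> mono t \<Longrightarrow>
      indep_vars (\<lambda>_. count_space UNIV) (\<lambda>i \<omega>. N (t (Suc i)) \<omega> - N (t i) \<omega>) UNIV"

text \<open>The arrival times are the jump times of a counting path.\<close>

definition arrival_times :: "(real \<Rightarrow> nat) \<Rightarrow> real set" where
  "arrival_times c = {t. 0 < t \<and> (\<forall>s. 0 \<le> s \<and> s < t \<longrightarrow> c s < c t)}"

section \<open>The majority rule model on the integers\<close>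

text \<open>A configuration is the set of vertices with opinion 1.\<close>

type_synonym config = "int set"

definition hyperedge :: "nat \<Rightarrow> int \<Rightarrow> int set" where
  "hyperedge n x = {x..<x + int n}"

definition majority_update :: "nat \<Rightarrow> int \<Rightarrow> config \<Rightarrow> config" where
  "majority_update n x \<zeta> =
    (if real (card (\<zeta> \<inter> hyperedge n x)) < real n / 2
     then \<zeta> - hyperedge n x else \<zeta> \<union> hyperedge n x)"

text \<open>
  The left limit of a path at \<open>t\<close>, in the product topology on configurations, i.e.
  \<open>\<zeta>\<close> is the configuration just before time \<open>t\<close>.
\<close>

definition left_limit :: "(real \<Rightarrow> config) \<Rightarrow> real \<Rightarrow> config \<Rightarrow> bool" where
  "left_limit \<xi> t \<zeta> \<longleftrightarrow> (\<forall>z. eventually (\<lambda>s. z \<in> \<xi> s \<longleftrightarrow> z \<in> \<zeta>) (at_left t))"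

text \<open>
  \<open>A x\<close> is the set of arrival times attached to the hyperedge at \<open>x\<close>.
  On the infinite lattice the set of all arrival times is dense, so the
  dynamics cannot be described by a global sequence of jumps. Instead, a path is right
  continuous with left limits in the product topology, each arrival updates the vertices of its
  hyperedge from the configuration just before it, and a vertex that lies in no
  hyperedge with an arrival at time \<open>t\<close> keeps its opinion at time \<open>t\<close>.
\<close>

definition majority_rule_path ::
    "nat \<Rightarrow> (int \<Rightarrow> real set) \<Rightarrow> (real \<Rightarrow> config) \<Rightarrow> bool" where
  "majority_rule_path n A \<xi> \<longleftrightarrow>
    (\<forall>t\<ge>0. \<forall>z. eventually (\<lambda>s. z \<in> \<xi> s \<longleftrightarrow> z \<in> \<xi> t) (at_right t)) \<and>
    (\<forall>t>0. \<exists>\<zeta>. left_limit \<xi> t \<zeta> \<and>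
      (\<forall>x. t \<in> A x \<longrightarrow> (\<forall>z\<in>hyperedge n x. z \<in> \<xi> t \<longleftrightarrow> z \<in> majority_update n x \<zeta>)) \<and>
      (\<forall>z. (\<forall>x. z \<in> hyperedge n x \<longrightarrow> t \<notin> A x) \<longrightarrow> (z \<in> \<xi> t \<longleftrightarrow> z \<in> \<zeta>)))"

text \<open>
  Independence of the Poisson processes is independence of their paths, as random elements
  of the product space over all times.
\<close>

locale majority_rule_process = prob_space M
  for M :: "'w measure" and n :: nat and N :: "int \<Rightarrow> real \<Rightarrow> 'w \<Rightarrow> nat"
    and \<eta> :: "real \<Rightarrow> 'w \<Rightarrow> config" +
  assumes clocks_poisson: "\<And>x. poisson_process M 1 (N x)"
    and clocks_indep: "indep_vars (\<lambda>_. PiM {0..} (\<lambda>_. count_space UNIV))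
      (\<lambda>x \<omega>. \<lambda>t\<in>{0..}. N x t \<omega>) UNIV"
    and measurable_opinion: "\<And>t z. 0 \<le> t \<Longrightarrow> Measurable.pred M (\<lambda>\<omega>. z \<in> \<eta> t \<omega>)"
    and dynamics: "AE \<omega> in M.
      majority_rule_path n (\<lambda>x. arrival_times (\<lambda>t. N x t \<omega>)) (\<lambda>t. \<eta> t \<omega>)"

end

theory Submission
  imports Defs
begin

text \<open>
  Consider an interval of ones whose outside may be as hostile as possible. A ring of a hyperedge
  that covers \<open>j\<close> ones at the right end of the interval moves the right boundary by
  \<open>n - j\<close> to the right if \<open>j \<ge> n/2\<close>, and by \<open>j\<close> to the left otherwise. Because ties favour ones,
  the tie \<open>j = n/2\<close> has no counterpart among the losses, while all other moves cancel in pairs.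
  Each boundary therefore performs a random walk with positive outward drift: a long interval
  survives with probability close to one and, if it survives, it swallows every vertex. Since
  infinitely many hyperedges start with a majority of ones, and each of them independently has a
  positive chance to grow into an interval of any prescribed length, some long interval appears
  almost surely.

  To make this precise without solving the infinite particle system, time is cut into steps of
  length \<open>d\<close>, and only the set \<open>R k\<close> of hyperedges that ring at least once during step \<open>k\<close> is
  recorded. By \<open>ring_field_clock_rings\<close> these sets form an independent field of coin flips with
  bias \<open>q = 1 - exp (- d)\<close>. For small \<open>q\<close>, near a given boundary usually at most one
  hyperedge rings in a step, and then its move is the one described above. In the remaining cases the
  boundary is withdrawn by multiples of \<open>n\<close> to the first point across which nothing rings. Such a point shields
  everything behind it, whatever happens in front of it. This prescription is a deterministic
  function \<open>right_move\<close> of the ring set, and \<open>interval_step\<close> shows that every path of the dynamics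
  keeps the resulting interval filled with ones while the boundaries stay \<open>4n\<close> apart.

  The loss in the withdrawal case has an exponential moment of order \<open>q\<^sup>2\<close>, whereas the drift
  contributes a gain of order \<open>q\<close>. Hence some \<open>\<theta> > 0\<close> and small \<open>q\<close> give
  \<open>E [exp (- \<theta> \<cdot> move)] < 1\<close> (\<open>exp_right_move\<close>, \<open>step_factor_contracts\<close>), and this bound
  multiplies along the steps (\<open>exp_right_edge\<close>). By Markov's inequality and a geometric series over
  all steps, the event that a boundary ever loses \<open>D\<close> sites has probability at most a constant times
  \<open>exp (- \<theta> D)\<close>. The same inequality shows that after many steps both boundaries are beyond any given vertex.

  In \<open>prob_zero_at_grid_time\<close> this is combined with \<open>prob_no_growth_event\<close>: among \<open>I\<close> hyperedges
  with a majority of ones and disjoint neighbourhoods, the probability that none produces a long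
  interval decays geometrically in \<open>I\<close>, and given the first that succeeds, the later steps are
  independent of that success.
\<close>

section \<open>Ones along a path of the dynamics\<close>

lemma finite_hyperedge [simp]: "finite (hyperedge n x)"
  by (simp add: hyperedge_def)

lemma card_hyperedge [simp]: "card (hyperedge n x) = n"
  by (simp add: hyperedge_def)

lemma majority_updateI:
  assumes "n \<le> 2 * card (S \<inter> hyperedge n x)" and "S \<subseteq> \<zeta>" and "z \<in> hyperedge n x"
  shows "z \<in> majority_update n x \<zeta>"
proof -
  have "card (S \<inter> hyperedge n x) \<le> card (\<zeta> \<inter> hyperedge n x)"
    using assms(2) by (intro card_mono) auto
  then have "\<not> real (card (\<zeta> \<inter> hyperedge n x)) < real n / 2"
    using assms(1) by linarith
  then show ?thesis
    using assms(3) by (simp add: majority_update_def)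
qed

lemma left_limit_superset:
  assumes "left_limit \<xi> u \<zeta>" and "s < u" and "\<And>v. s \<le> v \<Longrightarrow> v < u \<Longrightarrow> S \<subseteq> \<xi> v"
  shows "S \<subseteq> \<zeta>"
proof
  fix z assume z: "z \<in> S"
  have "eventually (\<lambda>v. z \<in> \<xi> v \<longleftrightarrow> z \<in> \<zeta>) (at_left u)"
    using assms(1) by (simp add: left_limit_def)
  moreover have "eventually (\<lambda>v. z \<in> \<xi> v) (at_left u)"
    using eventually_at_left_real[OF assms(2)] by (rule eventually_mono) (use assms(3) z in \<open>auto simp: subset_iff\<close>)
  ultimately have "eventually (\<lambda>v. z \<in> \<zeta>) (at_left u)"
    by eventually_elim simp
  then show "z \<in> \<zeta>"
    by simp
qed

lemma jump_configuration:
  assumes "majority_rule_path n A \<xi>" and "0 < u"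
  obtains \<zeta> where "left_limit \<xi> u \<zeta>"
    and "\<And>x z. u \<in> A x \<Longrightarrow> z \<in> hyperedge n x \<Longrightarrow> z \<in> \<xi> u \<longleftrightarrow> z \<in> majority_update n x \<zeta>"
    and "\<And>z. (\<And>x. z \<in> hyperedge n x \<Longrightarrow> u \<notin> A x) \<Longrightarrow> z \<in> \<xi> u \<longleftrightarrow> z \<in> \<zeta>"
proof -
  obtain \<zeta> where "left_limit \<xi> u \<zeta>"
    and "\<forall>x. u \<in> A x \<longrightarrow> (\<forall>z\<in>hyperedge n x. z \<in> \<xi> u \<longleftrightarrow> z \<in> majority_update n x \<zeta>)"
    and "\<forall>z. (\<forall>x. z \<in> hyperedge n x \<longrightarrow> u \<notin> A x) \<longrightarrow> (z \<in> \<xi> u \<longleftrightarrow> z \<in> \<zeta>)"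
    using assms(1)[unfolded majority_rule_path_def, THEN conjunct2, rule_format, OF assms(2)]
    by (elim exE conjE)
  then show ?thesis by (intro that) simp_all
qed

lemma arrival_fills:
  assumes path: "majority_rule_path n A \<xi>" and "0 \<le> s" "s < u"
    and before: "\<And>v. s \<le> v \<Longrightarrow> v < u \<Longrightarrow> S \<subseteq> \<xi> v"
    and "u \<in> A x" and maj: "n \<le> 2 * card (S \<inter> hyperedge n x)"
  shows "hyperedge n x \<subseteq> \<xi> u"
proof -
  have "0 < u" using \<open>0 \<le> s\<close> \<open>s < u\<close> by simp
  then obtain \<zeta> where \<zeta>: "left_limit \<xi> u \<zeta>"
      "\<And>z. z \<in> hyperedge n x \<Longrightarrow> z \<in> \<xi> u \<longleftrightarrow> z \<in> majority_update n x \<zeta>"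
    using path \<open>u \<in> A x\<close> by (metis jump_configuration)
  have "S \<subseteq> \<zeta>" using left_limit_superset[OF \<zeta>(1) \<open>s < u\<close> before] .
  then show ?thesis
    using majority_updateI[OF maj] \<zeta>(2) by blast
qed

text \<open>
  Arrival times of infinitely many hyperedges are dense, so there is no induction over jumps. The
  argument runs along the time axis instead: the infimum \<open>u\<close> of the bad times cannot be bad,
  because the left limit at \<open>u\<close> still contains \<open>S\<close> and every relevant arrival at \<open>u\<close> sees a
  majority. It cannot be good either, because finitely many vertices stay constant for
  a while to the right of \<open>u\<close>.
\<close>

lemma ones_persist:
  assumes path: "majority_rule_path n A \<xi>" and "0 \<le> s" "s \<le> t"
    and fin: "finite S" and start: "S \<subseteq> \<xi> s"
    and maj: "\<And>u x. s < u \<Longrightarrow> u \<le> t \<Longrightarrow> u \<in> A x \<Longrightarrow> hyperedge n x \<inter> S \<noteq> {} \<Longrightarrow>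
      n \<le> 2 * card (S \<inter> hyperedge n x)"
  shows "S \<subseteq> \<xi> t"
proof (rule ccontr)
  define B where "B = {u. s \<le> u \<and> u \<le> t \<and> \<not> S \<subseteq> \<xi> u}"
  assume "\<not> S \<subseteq> \<xi> t"
  then have "t \<in> B" using \<open>s \<le> t\<close> by (simp add: B_def)
  have bdd: "bdd_below B" by (rule bdd_belowI[of _ s]) (simp add: B_def)
  define u where "u = Inf B"
  have "u \<le> t" unfolding u_def using \<open>t \<in> B\<close> bdd by (rule cInf_lower)
  have "s \<le> u" unfolding u_def using \<open>t \<in> B\<close> by (intro cInf_greatest) (auto simp: B_def)
  have before: "S \<subseteq> \<xi> v" if "s \<le> v" "v < u" for v
  proof (rule ccontr)
    assume "\<not> S \<subseteq> \<xi> v"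
    then have "v \<in> B" using that \<open>u \<le> t\<close> by (simp add: B_def)
    then have "u \<le> v" unfolding u_def using bdd by (rule cInf_lower)
    then show False using that by simp
  qed
  have at_u: "S \<subseteq> \<xi> u"
  proof (cases "u = s")
    case True
    then show ?thesis using start by simp
  next
    case False
    then have "s < u" "0 < u" using \<open>s \<le> u\<close> \<open>0 \<le> s\<close> by auto
    then obtain \<zeta> where \<zeta>: "left_limit \<xi> u \<zeta>"
        "\<And>z. (\<And>x. z \<in> hyperedge n x \<Longrightarrow> u \<notin> A x) \<Longrightarrow> z \<in> \<xi> u \<longleftrightarrow> z \<in> \<zeta>"
      using jump_configuration[OF path] by metis
    have sub: "S \<subseteq> \<zeta>" using left_limit_superset[OF \<zeta>(1) \<open>s < u\<close> before] .
    show ?thesis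
    proof
      fix z assume z: "z \<in> S"
      show "z \<in> \<xi> u"
      proof (cases "\<exists>x. z \<in> hyperedge n x \<and> u \<in> A x")
        case True
        then obtain x where x: "z \<in> hyperedge n x" "u \<in> A x" by blast
        then have "n \<le> 2 * card (S \<inter> hyperedge n x)"
          using maj[OF \<open>s < u\<close> \<open>u \<le> t\<close> x(2)] z by blast
        from arrival_fills[OF path \<open>0 \<le> s\<close> \<open>s < u\<close> before x(2) this] x(1)
        show ?thesis by blast
      next
        case False
        then show ?thesis
          using \<zeta>(2)[of z] sub z by blast
      qed
    qed
  qed
  have "\<forall>z\<in>S. eventually (\<lambda>v. z \<in> \<xi> v) (at_right u)"
  proof
    fix z assume "z \<in> S"
    have "eventually (\<lambda>v. z \<in> \<xi> v \<longleftrightarrow> z \<in> \<xi> u) (at_right u)"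
      using path[unfolded majority_rule_path_def, THEN conjunct1] \<open>0 \<le> s\<close> \<open>s \<le> u\<close> by simp
    then show "eventually (\<lambda>v. z \<in> \<xi> v) (at_right u)"
      using at_u \<open>z \<in> S\<close> by (auto elim: eventually_mono)
  qed
  then have "eventually (\<lambda>v. \<forall>z\<in>S. z \<in> \<xi> v) (at_right u)"
    using fin by (simp add: eventually_ball_finite_distrib)
  then obtain w where w: "u < w" "\<And>v. u < v \<Longrightarrow> v < w \<Longrightarrow> S \<subseteq> \<xi> v"
    unfolding eventually_at_right_field by blast
  have "w \<le> Inf B"
  proof (rule cInf_greatest)
    show "B \<noteq> {}" using \<open>t \<in> B\<close> by blast
    fix v assume v: "v \<in> B"
    then have "u \<le> v" unfolding u_def using bdd by (rule cInf_lower)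
    then show "w \<le> v"
      using v w at_u by (cases "v = u") (force simp: B_def)+
  qed
  then show False using w(1) by (simp add: u_def)
qed

text \<open>
  The number of arrivals of \<open>y\<close> does not matter: before the first one \<open>S\<close> persists, the first one
  fills the hyperedge, and later ones see a hyperedge full of ones. So it is enough to know which
  hyperedges ring in a time interval, not how often or in which order.
\<close>

lemma ones_spread:
  assumes path: "majority_rule_path n A \<xi>" and "0 \<le> s"
    and fin: "finite S" and start: "S \<subseteq> \<xi> s"
    and u: "s < u" "u \<le> t" "u \<in> A y" and maj: "n \<le> 2 * card (S \<inter> hyperedge n y)"
    and quiet: "\<And>v x. s < v \<Longrightarrow> v \<le> t \<Longrightarrow> v \<in> A x \<Longrightarrow>
      hyperedge n x \<inter> (S \<union> hyperedge n y) \<noteq> {} \<Longrightarrow> x = y"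
  shows "S \<union> hyperedge n y \<subseteq> \<xi> t"
proof -
  have keep: "S \<subseteq> \<xi> v" if "s \<le> v" "v \<le> t" for v
  proof (rule ones_persist[OF path \<open>0 \<le> s\<close> that(1) fin start])
    fix w x assume w: "s < w" "w \<le> v" "w \<in> A x" "hyperedge n x \<inter> S \<noteq> {}"
    then have "x = y" using quiet[of w x] that by auto
    then show "n \<le> 2 * card (S \<inter> hyperedge n x)" using maj by simp
  qed
  have "hyperedge n y \<subseteq> \<xi> u"
    using keep u by (intro arrival_fills[where S = S, OF path \<open>0 \<le> s\<close> u(1) _ u(3) maj]) simp
  moreover have "S \<subseteq> \<xi> u" using keep u by simp
  ultimately have "S \<union> hyperedge n y \<subseteq> \<xi> u" by simp
  then show ?thesis
  proof (rule ones_persist[OF path _ u(2), rotated 2])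
    fix w x assume w: "u < w" "w \<le> t" "w \<in> A x" "hyperedge n x \<inter> (S \<union> hyperedge n y) \<noteq> {}"
    then have "x = y" using quiet[of w x] u by simp
    moreover have "(S \<union> hyperedge n y) \<inter> hyperedge n y = hyperedge n y" by blast
    ultimately show "n \<le> 2 * card ((S \<union> hyperedge n y) \<inter> hyperedge n x)" by simp
  qed (use fin u \<open>0 \<le> s\<close> in auto)
qed

section \<open>Moves of the boundaries of an interval of ones\<close>

text \<open>
  A boundary at \<open>b\<close> separates the vertices \<open>b - 1\<close> and \<open>b\<close>. These are the positions of the hyperedges
  that contain both of them.
\<close>

definition crossing :: "nat \<Rightarrow> int \<Rightarrow> int set" where
  "crossing n b = {b - int n<..<b}"

text \<open>
  Large enough to contain all hyperedges that can interfere with a single ring across \<open>b\<close>: those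
  across the point \<open>b - n\<close>, which then shields the rest of the interval, and those that meet the
  vertices gained to the right of \<open>b\<close>.
\<close>

definition window :: "nat \<Rightarrow> int \<Rightarrow> int set" where
  "window n b = {b - 2 * int n..b + int n}"

text \<open>
  The number of blocks of length \<open>n\<close> that have to be given up to reach a point across which nothing
  rings. If there is no such point, the value is arbitrary; this has probability zero.
\<close>

definition retreat :: "nat \<Rightarrow> int set \<Rightarrow> int \<Rightarrow> nat" where
  "retreat n R b = (LEAST j. 1 \<le> j \<and> R \<inter> crossing n (b - int n * int j) = {})"

text \<open>
  The move of a boundary at \<open>b\<close> when the hyperedge at \<open>y\<close> rings alone: \<open>b - y\<close> is the number of
  vertices that it covers inside the interval.
\<close>

definition ring_gain :: "nat \<Rightarrow> int \<Rightarrow> int \<Rightarrow> int" where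
  "ring_gain n b y = (if int n \<le> 2 * (b - y) then y + int n - b else y - b)"

text \<open>
  If exactly one hyperedge rings in the window, the boundary moves exactly as in the dynamics with
  zeros everywhere outside the interval. With several rings it retreats to a place that is safe in any
  order of the rings.
\<close>

definition right_move :: "nat \<Rightarrow> int set \<Rightarrow> int \<Rightarrow> int" where
  "right_move n R b =
    (if R \<inter> crossing n b = {} then 0
     else if \<exists>y. R \<inter> window n b = {y} then ring_gain n b (the_elem (R \<inter> window n b))
     else - int n * int (retreat n R b))"

text \<open>
  The time interval is open on the left and closed on the right, so that consecutive steps
  neither share nor miss an arrival.
\<close>

definition rung :: "(int \<Rightarrow> real set) \<Rightarrow> real \<Rightarrow> real \<Rightarrow> int set" where
  "rung A s t = {x. \<exists>u. s < u \<and> u \<le> t \<and> u \<in> A x}"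

text \<open>
  A hyperedge that meets an interval but crosses neither end lies inside it, and a ring of it
  changes nothing.
\<close>

lemma ones_between_barriers:
  assumes path: "majority_rule_path n A \<xi>" and "0 \<le> s" "s \<le> t"
    and "rung A s t \<inter> crossing n a = {}" "rung A s t \<inter> crossing n b = {}"
    and "{a..<b} \<subseteq> \<xi> s"
  shows "{a..<b} \<subseteq> \<xi> t"
proof (rule ones_persist[OF path \<open>0 \<le> s\<close> \<open>s \<le> t\<close> _ \<open>{a..<b} \<subseteq> \<xi> s\<close>])
  fix u x assume u: "s < u" "u \<le> t" "u \<in> A x" and meet: "hyperedge n x \<inter> {a..<b} \<noteq> {}"
  have "x \<in> rung A s t" using u by (auto simp: rung_def)
  then have "x \<notin> crossing n a" "x \<notin> crossing n b" using assms by auto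
  then have "{a..<b} \<inter> hyperedge n x = hyperedge n x"
    using meet by (auto simp: crossing_def hyperedge_def)
  then show "n \<le> 2 * card ({a..<b} \<inter> hyperedge n x)" by simp
qed simp

text \<open>
  The point \<open>c\<close> is a place near the boundary across which nothing rings. The part of the interval to
  the right of \<open>c\<close> then evolves by itself, which decouples the right boundary from the left
  boundary.
\<close>

lemma right_step:
  fixes b :: int
  assumes path: "majority_rule_path n A \<xi>" and "0 \<le> s" "s \<le> t"
  defines "R \<equiv> rung A s t"
  assumes free: "\<exists>j\<ge>1. R \<inter> crossing n (b - int n * int j) = {}"
  defines "b' \<equiv> b + right_move n R b"
  obtains c where "c \<le> b" "c \<le> b'" "b' \<le> c + 2 * int n" "R \<inter> crossing n c = {}"
    "{c..<b} \<subseteq> \<xi> s \<longrightarrow> {c..<b'} \<subseteq> \<xi> t"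
proof (cases "R \<inter> crossing n b = {}")
  case True
  then have "b' = b" by (simp add: b'_def right_move_def)
  with True show ?thesis by (intro that[of b]) auto
next
  case hit: False
  show ?thesis
  proof (cases "\<exists>y. R \<inter> window n b = {y}")
    case False
    define J where "J = retreat n R b"
    have J: "1 \<le> J" "R \<inter> crossing n (b - int n * int J) = {}"
      unfolding J_def retreat_def using LeastI_ex[OF free] by auto
    have "b' = b - int n * int J"
      using hit False by (simp add: b'_def right_move_def J_def)
    with J show ?thesis by (intro that[of b']) auto
  next
    case True
    then obtain y where y: "R \<inter> window n b = {y}" by blast
    have "crossing n b \<subseteq> window n b" by (auto simp: crossing_def window_def)
    moreover obtain w where "w \<in> R" "w \<in> crossing n b" using hit by blast
    ultimately have "w \<in> R \<inter> window n b" by blast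
    with y \<open>w \<in> crossing n b\<close> have yc: "y \<in> crossing n b" by simp
    have b': "b' = b + ring_gain n b y"
      using hit y by (simp add: b'_def right_move_def)
    have only: "x = y" if "s < v" "v \<le> t" "v \<in> A x" "x \<in> window n b" for v x
    proof -
      have "x \<in> R" using that by (auto simp: R_def rung_def)
      then show ?thesis using y that by blast
    qed
    define c where "c = b - int n"
    have "R \<inter> crossing n c = {}"
    proof -
      have "crossing n c \<subseteq> window n b" "y \<notin> crossing n c"
        using yc by (auto simp: crossing_def window_def c_def)
      then have "R \<inter> crossing n c \<subseteq> {y}" using y by blast
      with \<open>y \<notin> crossing n c\<close> show ?thesis by blast
    qed
    moreover have "{c..<b'} \<subseteq> \<xi> t" if "{c..<b} \<subseteq> \<xi> s"
    proof (cases "int n \<le> 2 * (b - y)")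
      case gain: True
      have eq: "{c..<b} \<inter> hyperedge n y = {y..<b}" "{c..<b} \<union> hyperedge n y = {c..<b'}"
        using yc gain b' by (auto simp: c_def hyperedge_def crossing_def ring_gain_def)
      have "y \<in> R" using y by blast
      then obtain u where u: "s < u" "u \<le> t" "u \<in> A y" by (auto simp: R_def rung_def)
      have "{c..<b} \<union> hyperedge n y \<subseteq> \<xi> t"
      proof (rule ones_spread[OF path \<open>0 \<le> s\<close> _ that u])
        show "n \<le> 2 * card ({c..<b} \<inter> hyperedge n y)"
          using gain yc unfolding eq by (simp add: crossing_def)
        fix v x assume "s < v" "v \<le> t" "v \<in> A x"
          "hyperedge n x \<inter> ({c..<b} \<union> hyperedge n y) \<noteq> {}"
        then show "x = y"
          using yc by (intro only) (auto simp: hyperedge_def window_def crossing_def c_def)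
      qed simp
      then show ?thesis unfolding eq .
    next
      case False
      then have bloss: "b' = y" by (simp add: b' ring_gain_def)
      show ?thesis
      proof (rule ones_persist[OF path \<open>0 \<le> s\<close> \<open>s \<le> t\<close>])
        show "{c..<b'} \<subseteq> \<xi> s" using that yc by (auto simp: bloss crossing_def)
        fix u x assume u: "s < u" "u \<le> t" "u \<in> A x" and meet: "hyperedge n x \<inter> {c..<b'} \<noteq> {}"
        have "x = y" using u
          by (rule only) (use meet yc in \<open>auto simp: bloss hyperedge_def window_def crossing_def c_def\<close>)
        then show "n \<le> 2 * card ({c..<b'} \<inter> hyperedge n x)"
          using meet by (auto simp: bloss hyperedge_def)
      qed simp
    qed
    moreover have "c \<le> b" "c \<le> b'" "b' \<le> c + 2 * int n"
      using yc by (auto simp: b' c_def ring_gain_def crossing_def)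
    ultimately show ?thesis by (intro that[of c]) auto
  qed
qed

text \<open>
  The reflection \<open>z \<mapsto> - 1 - z\<close> of the vertices maps the interval \<open>{a..<b}\<close> to \<open>{- b..<- a}\<close> and the
  hyperedge at \<open>x\<close> to the one at \<open>- x - n\<close>. It turns left boundaries into right boundaries.
\<close>

definition mirror_rings :: "nat \<Rightarrow> int set \<Rightarrow> int set" where
  "mirror_rings n R = {x. - x - int n \<in> R}"

definition left_move :: "nat \<Rightarrow> int set \<Rightarrow> int \<Rightarrow> int" where
  "left_move n R a = - right_move n (mirror_rings n R) (- a)"

lemma mirror_majority_rule_path:
  assumes "majority_rule_path n A \<xi>"
  shows "majority_rule_path n (\<lambda>x. A (- x - int n)) (\<lambda>u. {z. - 1 - z \<in> \<xi> u})"
proof -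
  have edge: "- 1 - z \<in> hyperedge n x \<longleftrightarrow> z \<in> hyperedge n (- x - int n)" for z x
    by (auto simp: hyperedge_def)
  have upd: "z \<in> majority_update n x {z. - 1 - z \<in> \<zeta>} \<longleftrightarrow>
      - 1 - z \<in> majority_update n (- x - int n) \<zeta>" for z x \<zeta>
  proof -
    have "{z. - 1 - z \<in> \<zeta>} \<inter> hyperedge n x = (\<lambda>z. - 1 - z) ` (\<zeta> \<inter> hyperedge n (- x - int n))"
      (is "?L = ?f ` ?R")
    proof (intro equalityI subsetI)
      fix z assume "z \<in> ?L"
      then have "?f z \<in> ?R" "z = ?f (?f z)" by (auto simp: hyperedge_def)
      then show "z \<in> ?f ` ?R" by blast
    qed (auto simp: hyperedge_def)
    moreover have "inj_on ?f ?R" by (auto simp: inj_on_def)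
    ultimately have "card ?L = card ?R" by (simp add: card_image)
    then show ?thesis using edge[of z "- x - int n"] by (simp add: majority_update_def)
  qed
  have right: "eventually (\<lambda>s. z \<in> \<xi> s \<longleftrightarrow> z \<in> \<xi> t) (at_right t)" if "0 \<le> t" for t z
    using assms[unfolded majority_rule_path_def, THEN conjunct1] that by simp
  show ?thesis
    unfolding majority_rule_path_def
  proof (intro conjI allI impI)
    fix t :: real and z :: int assume "0 \<le> t"
    then show "eventually (\<lambda>s. z \<in> {z. - 1 - z \<in> \<xi> s} \<longleftrightarrow> z \<in> {z. - 1 - z \<in> \<xi> t}) (at_right t)"
      using right by simp
  next
    fix t :: real assume "0 < t"
    then obtain \<zeta> where \<zeta>: "left_limit \<xi> t \<zeta>"
      "\<And>x z. t \<in> A x \<Longrightarrow> z \<in> hyperedge n x \<Longrightarrow> z \<in> \<xi> t \<longleftrightarrow> z \<in> majority_update n x \<zeta>"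
      "\<And>z. (\<And>x. z \<in> hyperedge n x \<Longrightarrow> t \<notin> A x) \<Longrightarrow> z \<in> \<xi> t \<longleftrightarrow> z \<in> \<zeta>"
      using jump_configuration[OF assms] by metis
    show "\<exists>\<zeta>. left_limit (\<lambda>u. {z. - 1 - z \<in> \<xi> u}) t \<zeta> \<and>
      (\<forall>x. t \<in> A (- x - int n) \<longrightarrow>
        (\<forall>z\<in>hyperedge n x. z \<in> {z. - 1 - z \<in> \<xi> t} \<longleftrightarrow> z \<in> majority_update n x \<zeta>)) \<and>
      (\<forall>z. (\<forall>x. z \<in> hyperedge n x \<longrightarrow> t \<notin> A (- x - int n)) \<longrightarrow>
        (z \<in> {z. - 1 - z \<in> \<xi> t} \<longleftrightarrow> z \<in> \<zeta>))"
    proof (intro exI[of _ "{z. - 1 - z \<in> \<zeta>}"] conjI allI impI ballI)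
      show "left_limit (\<lambda>u. {z. - 1 - z \<in> \<xi> u}) t {z. - 1 - z \<in> \<zeta>}"
        using \<zeta>(1) by (simp add: left_limit_def)
      show "z \<in> {z. - 1 - z \<in> \<xi> t} \<longleftrightarrow> z \<in> majority_update n x {z. - 1 - z \<in> \<zeta>}"
        if "t \<in> A (- x - int n)" "z \<in> hyperedge n x" for x z
        using \<zeta>(2)[OF that(1), of "- 1 - z"] edge[of z "- x - int n"] that(2) upd by simp
      show "z \<in> {z. - 1 - z \<in> \<xi> t} \<longleftrightarrow> z \<in> {z. - 1 - z \<in> \<zeta>}"
        if quiet: "\<forall>x. z \<in> hyperedge n x \<longrightarrow> t \<notin> A (- x - int n)" for z
      proof -
        have "t \<notin> A x" if "- 1 - z \<in> hyperedge n x" for x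
          using that edge[of z x] quiet[rule_format, of "- x - int n"] by simp
        then show ?thesis using \<zeta>(3)[of "- 1 - z"] by simp
      qed
    qed
  qed
qed

lemma mirror_crossing: "mirror_rings n R \<inter> crossing n (- a) = {} \<longleftrightarrow> R \<inter> crossing n a = {}"
proof -
  have "mirror_rings n R \<inter> crossing n (- a) = (\<lambda>x. - x - int n) ` (R \<inter> crossing n a)"
    (is "?L = ?f ` ?R")
  proof (intro equalityI subsetI)
    fix x assume "x \<in> ?L"
    then have "?f x \<in> ?R" "x = ?f (?f x)" by (auto simp: mirror_rings_def crossing_def)
    then show "x \<in> ?f ` ?R" by (rule rev_image_eqI)
  qed (auto simp: mirror_rings_def crossing_def)
  then show ?thesis by simp
qed

text \<open>
  Each boundary comes with a barrier at distance at most \<open>2n\<close> from its new position. The bound \<open>4n\<close> on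
  the new length keeps the two barriers in order, so that the pieces outside and between them fit
  together.
\<close>

lemma interval_step:
  fixes a b :: int
  assumes path: "majority_rule_path n A \<xi>" and "0 \<le> s" "s \<le> t"
  defines "R \<equiv> rung A s t"
  assumes right_free: "\<exists>j\<ge>1. R \<inter> crossing n (b - int n * int j) = {}"
    and left_free: "\<exists>j\<ge>1. mirror_rings n R \<inter> crossing n (- a - int n * int j) = {}"
    and start: "{a..<b} \<subseteq> \<xi> s"
    and long: "4 * int n \<le> (b + right_move n R b) - (a + left_move n R a)"
  shows "{a + left_move n R a..<b + right_move n R b} \<subseteq> \<xi> t"
proof -
  have "rung (\<lambda>x. A (- x - int n)) s t = mirror_rings n R"
    by (auto simp: rung_def R_def mirror_rings_def)
  note left = right_step[OF mirror_majority_rule_path[OF path] \<open>0 \<le> s\<close> \<open>s \<le> t\<close>,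
      unfolded this, OF left_free]
  obtain e where e: "e \<le> - a" "e \<le> - a + right_move n (mirror_rings n R) (- a)"
    "- a + right_move n (mirror_rings n R) (- a) \<le> e + 2 * int n"
    "mirror_rings n R \<inter> crossing n e = {}"
    "{e..<- a} \<subseteq> {z. - 1 - z \<in> \<xi> s} \<longrightarrow> {e..<- a + right_move n (mirror_rings n R) (- a)} \<subseteq> {z. - 1 - z \<in> \<xi> t}"
    using left .
  obtain c where c: "c \<le> b" "c \<le> b + right_move n R b"
    "b + right_move n R b \<le> c + 2 * int n" "R \<inter> crossing n c = {}"
    "{c..<b} \<subseteq> \<xi> s \<longrightarrow> {c..<b + right_move n R b} \<subseteq> \<xi> t"
    using right_step[OF path \<open>0 \<le> s\<close> \<open>s \<le> t\<close>, folded R_def, OF right_free] .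
  define d where "d = - e"
  have d: "a \<le> d" "a + left_move n R a \<le> d" "d \<le> a + left_move n R a + 2 * int n"
    "R \<inter> crossing n d = {}"
    using e mirror_crossing[of n R d] by (auto simp: d_def left_move_def)
  have dl: "{a + left_move n R a..<d} \<subseteq> \<xi> t" if "{a..<d} \<subseteq> \<xi> s"
  proof -
    have "{e..<- a} \<subseteq> {z. - 1 - z \<in> \<xi> s}" using that by (auto simp: d_def subset_iff)
    then have le: "{e..<- a + right_move n (mirror_rings n R) (- a)} \<subseteq> {z. - 1 - z \<in> \<xi> t}"
      using e by blast
    show ?thesis
    proof
      fix z assume "z \<in> {a + left_move n R a..<d}"
      then have "- 1 - z \<in> {e..<- a + right_move n (mirror_rings n R) (- a)}"
        by (auto simp: left_move_def d_def)
      then have "- 1 - z \<in> {z. - 1 - z \<in> \<xi> t}" using le by blast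
      then show "z \<in> \<xi> t" by simp
    qed
  qed
  have "d \<le> c" using d c long by linarith
  then have sub: "{a..<d} \<subseteq> \<xi> s" "{c..<b} \<subseteq> \<xi> s" "{d..<c} \<subseteq> \<xi> s"
    using start d c by (auto simp: subset_iff)
  have "{d..<c} \<subseteq> \<xi> t"
    using ones_between_barriers[OF path \<open>0 \<le> s\<close> \<open>s \<le> t\<close> _ _ sub(3)] d c by (simp add: R_def)
  moreover have "{c..<b + right_move n R b} \<subseteq> \<xi> t" using c(5) sub(2) by blast
  moreover note dl[OF sub(1)]
  moreover have "{a + left_move n R a..<b + right_move n R b} \<subseteq>
      {a + left_move n R a..<d} \<union> {d..<c} \<union> {c..<b + right_move n R b}"
    by auto
  ultimately show ?thesis by blast
qed

section \<open>Independent fields of rings\<close>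

definition ring_event :: "'w measure \<Rightarrow> (nat \<Rightarrow> 'w \<Rightarrow> int set) \<Rightarrow> nat \<times> int \<Rightarrow> 'w set" where
  "ring_event M R = (\<lambda>(k, y). {\<omega> \<in> space M. y \<in> R k \<omega>})"

definition ring_algebra :: "'w measure \<Rightarrow> (nat \<Rightarrow> 'w \<Rightarrow> int set) \<Rightarrow> (nat \<times> int) set \<Rightarrow> 'w measure" where
  "ring_algebra M R K = sigma (space M) (ring_event M R ` K)"

definition past :: "'w measure \<Rightarrow> (nat \<Rightarrow> 'w \<Rightarrow> int set) \<Rightarrow> nat \<Rightarrow> 'w measure" where
  "past M R k = ring_algebra M R ({..<k} \<times> UNIV)"

lemma space_ring_algebra [simp]: "space (ring_algebra M R K) = space M"
  unfolding ring_algebra_def by (rule space_measure_of) (auto simp: ring_event_def)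

lemma sets_ring_algebra: "sets (ring_algebra M R K) = sigma_sets (space M) (ring_event M R ` K)"
  unfolding ring_algebra_def by (rule sets_measure_of) (auto simp: ring_event_def)

lemma space_past [simp]: "space (past M R k) = space M"
  by (simp add: past_def)

lemma ring_algebra_mono: "K \<subseteq> L \<Longrightarrow> sets (ring_algebra M R K) \<subseteq> sets (ring_algebra M R L)"
  unfolding sets_ring_algebra by (intro sigma_sets_subseteq image_mono)

lemma past_mono: "k \<le> l \<Longrightarrow> sets (past M R k) \<subseteq> sets (past M R l)"
  unfolding past_def by (intro ring_algebra_mono) auto

lemma ring_measurable:
  assumes "(k, y) \<in> K"
  shows "Measurable.pred (ring_algebra M R K) (\<lambda>\<omega>. y \<in> R k \<omega>)"
proof -
  have "ring_event M R (k, y) \<in> sets (ring_algebra M R K)"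
    unfolding sets_ring_algebra using assms by (intro sigma_sets.Basic) auto
  then show ?thesis by (simp add: ring_event_def pred_def)
qed

lemma ring_measurable_past: "k < l \<Longrightarrow> Measurable.pred (past M R l) (\<lambda>\<omega>. y \<in> R k \<omega>)"
  unfolding past_def by (rule ring_measurable) simp

text \<open>
  The ring sets of the successive steps as a field of independent coin flips with bias \<open>q\<close>, indexed by
  step and position. All probabilistic estimates use only this structure.
\<close>

locale ring_field = prob_space M
  for M :: "'w measure" and R :: "nat \<Rightarrow> 'w \<Rightarrow> int set" and q :: real +
  assumes rings_indep: "indep_events (ring_event M R) UNIV"
    and prob_ring: "prob (ring_event M R (k, y)) = q"
begin

lemma ring_event_in_events: "ring_event M R i \<in> events"
  using rings_indep by (auto simp: indep_events_def)

lemma q_bounds: "0 \<le> q" "q \<le> 1"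
  using prob_ring[of 0 0] prob_le_1[of "ring_event M R (0, 0)"] measure_nonneg[of M "ring_event M R (0, 0)"]
  by auto

lemma ring_algebra_events: "sets (ring_algebra M R K) \<subseteq> events"
  unfolding sets_ring_algebra using ring_event_in_events
  by (intro sets.sigma_sets_subset) auto

lemma past_events: "sets (past M R k) \<subseteq> events"
  unfolding past_def by (rule ring_algebra_events)

lemma past_measurableD: "f \<in> measurable (past M R k) N \<Longrightarrow> f \<in> measurable M N"
  using past_events[of k] by (auto simp: measurable_def)

lemma ring_algebras_indep:
  assumes "disjoint_family_on K J"
  shows "indep_sets (\<lambda>j. sets (ring_algebra M R (K j))) J"
proof -
  have "indep_sets (\<lambda>i. {ring_event M R i}) (\<Union>j\<in>J. K j)"
    using rings_indep unfolding indep_events_def_alt by (rule indep_sets_mono_index[rotated]) simp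
  then have "indep_sets (\<lambda>j. sigma_sets (space M) (\<Union>i\<in>K j. {ring_event M R i})) J"
    by (rule indep_sets_collect_sigma[OF _ _ assms]) (simp add: Int_stable_def)
  moreover have "(\<Union>i\<in>K j. {ring_event M R i}) = ring_event M R ` K j" for j
    by auto
  ultimately show ?thesis by (simp add: sets_ring_algebra)
qed

lemma prob_Int_disjoint:
  assumes "A \<in> sets (ring_algebra M R K)" "B \<in> sets (ring_algebra M R L)" "K \<inter> L = {}"
  shows "prob (A \<inter> B) = prob A * prob B"
proof -
  have "disjoint_family_on (case_bool K L) UNIV"
    using assms(3) by (auto simp: disjoint_family_on_def split: bool.split)
  from indep_setsD[OF ring_algebras_indep[OF this], of UNIV "case_bool A B"]
  have "prob (\<Inter>j\<in>UNIV. case_bool A B j) = (\<Prod>j\<in>UNIV. prob (case_bool A B j))"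
    using assms(1,2) by (simp split: bool.split)
  then show ?thesis by (simp add: UNIV_bool Int_commute)
qed

definition pattern :: "nat \<Rightarrow> int set \<Rightarrow> int set \<Rightarrow> 'w set" where
  "pattern k U V = {\<omega> \<in> space M. U \<subseteq> R k \<omega> \<and> V \<inter> R k \<omega> = {}}"

lemma pattern_in_ring_algebra:
  assumes "finite U" "finite V" "{k} \<times> (U \<union> V) \<subseteq> K"
  shows "pattern k U V \<in> sets (ring_algebra M R K)"
proof -
  have [measurable]: "Measurable.pred (ring_algebra M R K) (\<lambda>\<omega>. y \<in> R k \<omega>)" if "y \<in> U \<union> V" for y
    by (rule ring_measurable) (use assms(3) that in auto)
  have "pattern k U V =
      {\<omega> \<in> space (ring_algebra M R K). (\<forall>y\<in>U. y \<in> R k \<omega>) \<and> (\<forall>y\<in>V. y \<notin> R k \<omega>)}"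
    by (auto simp: pattern_def)
  also have "\<dots> \<in> sets (ring_algebra M R K)"
    using assms(1,2) by measurable
  finally show ?thesis .
qed

lemma pattern_in_past: "finite U \<Longrightarrow> finite V \<Longrightarrow> k < l \<Longrightarrow> pattern k U V \<in> sets (past M R l)"
  unfolding past_def by (rule pattern_in_ring_algebra) auto

lemma pattern_events: "finite U \<Longrightarrow> finite V \<Longrightarrow> pattern k U V \<in> events"
  using pattern_in_past[of U V k "Suc k"] past_events by auto

text \<open>
  The patterns are the events by which a boundary move is described, so this product formula is
  the form in which independence of a step from its past enters. Forbidden sites are added one at a
  time by subtracting the pattern in which the site is present.
\<close>

lemma prob_past_pattern:
  assumes A: "A \<in> sets (past M R k)" and "finite U" "finite V" "U \<inter> V = {}"
  shows "prob (A \<inter> pattern k U V) = prob A * (q ^ card U * (1 - q) ^ card V)"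
  using \<open>finite V\<close> \<open>finite U\<close> \<open>U \<inter> V = {}\<close>
proof (induction V arbitrary: U rule: finite_induct)
  case empty
  have "prob (pattern k U {}) = q ^ card U"
  proof (cases "U = {}")
    case True
    then show ?thesis by (simp add: pattern_def prob_space)
  next
    case False
    have "pattern k U {} = (\<Inter>i\<in>{k} \<times> U. ring_event M R i)"
      using False by (auto simp: pattern_def ring_event_def)
    also have "prob \<dots> = (\<Prod>i\<in>{k} \<times> U. prob (ring_event M R i))"
      using rings_indep False empty(1) by (simp add: indep_events_def)
    also have "\<dots> = (\<Prod>i\<in>{k} \<times> U. q)"
      by (intro prod.cong) (auto simp: prob_ring)
    finally show ?thesis using empty(1) by simp
  qed
  moreover have "prob (A \<inter> pattern k U {}) = prob A * prob (pattern k U {})"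
    using A empty(1) unfolding past_def
    by (rule prob_Int_disjoint[OF _ pattern_in_ring_algebra[where K = "{k} \<times> U"]]) auto
  ultimately show ?case by simp
next
  case (insert v V)
  have Aev: "A \<in> events" using A past_events by blast
  have eq: "A \<inter> pattern k U (insert v V) = A \<inter> pattern k U V - A \<inter> pattern k (insert v U) V"
    by (auto simp: pattern_def)
  have "prob (A \<inter> pattern k U (insert v V)) =
      prob (A \<inter> pattern k U V) - prob (A \<inter> pattern k (insert v U) V)"
    unfolding eq
    by (rule finite_measure_Diff)
      (use Aev insert pattern_events[of U V k] pattern_events[of "insert v U" V k]
        in \<open>auto simp: pattern_def\<close>)
  also have "\<dots> = prob A * (q ^ card U * (1 - q) ^ card V) -
      prob A * (q ^ card (insert v U) * (1 - q) ^ card V)"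
    using insert by (subst insert.IH, simp, simp, subst insert.IH) auto
  also have "\<dots> = prob A * (q ^ card U * (1 - q) ^ card (insert v V))"
    using insert by (simp add: algebra_simps)
  finally show ?case .
qed

end

text \<open>
  Reflection permutes the generators of the past. Events of the past can thus be combined with both the
  left and the right boundary.
\<close>

lemma past_mirror: "past M (\<lambda>k \<omega>. mirror_rings n (R k \<omega>)) l = past M R l"
proof -
  have "ring_event M (\<lambda>k \<omega>. mirror_rings n (R k \<omega>)) ` ({..<l} \<times> UNIV) =
      ring_event M R ` (\<lambda>(k, y). (k, - y - int n)) ` ({..<l} \<times> UNIV)"
    unfolding image_image by (intro image_cong) (auto simp: ring_event_def mirror_rings_def)
  also have "(\<lambda>(k, y). (k, - y - int n)) ` ({..<l} \<times> UNIV) = {..<l} \<times> (UNIV :: int set)"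
  proof (intro equalityI subsetI)
    fix i assume "i \<in> {..<l} \<times> (UNIV :: int set)"
    then show "i \<in> (\<lambda>(k, y). (k, - y - int n)) ` ({..<l} \<times> UNIV)"
      by (intro image_eqI[of _ _ "(fst i, - snd i - int n)"]) auto
  qed auto
  finally show ?thesis by (simp add: past_def ring_algebra_def)
qed

lemma (in ring_field) mirror_ring_field:
  "ring_field M (\<lambda>k \<omega>. mirror_rings n (R k \<omega>)) q"
proof
  define f :: "nat \<times> int \<Rightarrow> nat \<times> int" where "f = (\<lambda>(k, y). (k, - y - int n))"
  have ev: "ring_event M (\<lambda>k \<omega>. mirror_rings n (R k \<omega>)) i = ring_event M R (f i)" for i
    by (auto simp: ring_event_def mirror_rings_def f_def split: prod.split)
  have f: "inj_on f J" for J
    by (auto simp: f_def inj_on_def)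
  show "indep_events (ring_event M (\<lambda>k \<omega>. mirror_rings n (R k \<omega>))) UNIV"
  proof (rule indep_eventsI)
    fix J :: "(nat \<times> int) set" assume J: "finite J" "J \<noteq> {}"
    have "prob (\<Inter>i\<in>f ` J. ring_event M R i) = (\<Prod>i\<in>f ` J. prob (ring_event M R i))"
      using rings_indep[unfolded indep_events_def, THEN conjunct2, rule_format, of "f ` J"] J by blast
    then show "prob (\<Inter>i\<in>J. ring_event M (\<lambda>k \<omega>. mirror_rings n (R k \<omega>)) i) =
        (\<Prod>i\<in>J. prob (ring_event M (\<lambda>k \<omega>. mirror_rings n (R k \<omega>)) i))"
      by (simp add: ev prod.reindex[OF f])
  qed (simp add: ev ring_event_in_events)
  show "prob (ring_event M (\<lambda>k \<omega>. mirror_rings n (R k \<omega>)) (k, y)) = q" for k y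
    by (simp add: ev f_def prob_ring)
qed

section \<open>The exponential moment of a single move\<close>

lemma finite_crossing [simp]: "finite (crossing n b)"
  by (simp add: crossing_def)

lemma card_crossing: "card (crossing n b) = n - 1"
  by (simp add: crossing_def)

lemma finite_window [simp]: "finite (window n b)"
  by (simp add: window_def)

lemma card_window: "card (window n b) = 3 * n + 1"
  by (simp add: window_def)

lemma crossing_subset_window: "crossing n b \<subseteq> window n b"
  by (auto simp: crossing_def window_def)

lemma measurable_finite_trace:
  assumes "finite W" and [measurable]: "\<And>y. y \<in> W \<Longrightarrow> Measurable.pred N (\<lambda>\<omega>. y \<in> S \<omega>)"
  shows "(\<lambda>\<omega>. g (S \<omega> \<inter> W) :: 'b) \<in> measurable N (count_space UNIV)"
proof (rule measurableI)
  fix Q :: "'b set"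
  have "(\<lambda>\<omega>. g (S \<omega> \<inter> W)) -` Q \<inter> space N =
      {\<omega> \<in> space N. \<exists>T\<in>{T \<in> Pow W. g T \<in> Q}. \<forall>y\<in>W. y \<in> S \<omega> \<longleftrightarrow> y \<in> T}" (is "?L = ?R")
  proof (intro equalityI subsetI)
    fix \<omega> assume "\<omega> \<in> ?R"
    then obtain T where "\<omega> \<in> space N" "T \<subseteq> W" "g T \<in> Q" "\<forall>y\<in>W. y \<in> S \<omega> \<longleftrightarrow> y \<in> T"
      by auto
    moreover from this have "S \<omega> \<inter> W = T" by blast
    ultimately show "\<omega> \<in> ?L" by simp
  qed (auto intro!: bexI[of _ "S _ \<inter> W"])
  also have "\<dots> \<in> sets N"
  proof (intro predE pred_intros_finite(3,4) \<open>finite W\<close>)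
    show "finite {T \<in> Pow W. g T \<in> Q}" using \<open>finite W\<close> by simp
    show "Measurable.pred N (\<lambda>\<omega>. y \<in> S \<omega> \<longleftrightarrow> y \<in> T)" if "y \<in> W" for y T
      using that by measurable
  qed
  finally show "(\<lambda>\<omega>. g (S \<omega> \<inter> W)) -` Q \<inter> space N \<in> sets N" .
qed simp

lemma measurable_right_move:
  assumes [measurable]: "\<And>y. Measurable.pred N (\<lambda>\<omega>. y \<in> S \<omega>)"
  shows "(\<lambda>\<omega>. right_move n (S \<omega>) b) \<in> measurable N (count_space UNIV)"
proof -
  have empty: "R \<inter> crossing n c = {} \<longleftrightarrow> (\<forall>y\<in>crossing n c. y \<notin> R)" for R c
    by auto
  have "(\<lambda>\<omega>. retreat n (S \<omega>) b) \<in> measurable N (count_space UNIV)"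
    unfolding retreat_def empty by measurable
  then have [measurable]: "(\<lambda>\<omega>. - int n * int (retreat n (S \<omega>) b)) \<in> measurable N (count_space UNIV)"
    by measurable
  have [measurable]: "(\<lambda>\<omega>. ring_gain n b (the_elem (S \<omega> \<inter> window n b))) \<in> measurable N (count_space UNIV)"
    by (rule measurable_finite_trace) auto
  have [measurable]: "Measurable.pred N (\<lambda>\<omega>. \<exists>y. S \<omega> \<inter> window n b = {y})"
    by (rule measurable_finite_trace) auto
  have [measurable]: "Measurable.pred N (\<lambda>\<omega>. S \<omega> \<inter> crossing n b = {})"
    by (rule measurable_finite_trace) auto
  show ?thesis
    unfolding right_move_def by measurable
qed

context ring_field
begin

text \<open>
  Rings across each of the first \<open>J\<close> points \<open>b\<close>, \<open>b - n\<close>, \<open>b - 2n\<close>, and so on. The set \<open>U\<close> collects sites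
  already known to ring, which makes an induction on \<open>J\<close> possible.
\<close>

definition hits :: "nat \<Rightarrow> nat \<Rightarrow> int \<Rightarrow> nat \<Rightarrow> int set \<Rightarrow> 'w set" where
  "hits n k b J U = {\<omega> \<in> space M. U \<subseteq> R k \<omega> \<and>
    (\<forall>i<J. R k \<omega> \<inter> crossing n (b - int n * int i) \<noteq> {})}"

lemma ring_measurable_M [measurable]: "Measurable.pred M (\<lambda>\<omega>. y \<in> R k \<omega>)"
  by (rule past_measurableD[OF ring_measurable_past[of k "Suc k"]]) simp

lemma hits_events: "finite U \<Longrightarrow> hits n k b J U \<in> events"
proof -
  assume [simp]: "finite U"
  have "hits n k b J U = {\<omega> \<in> space M. (\<forall>y\<in>U. y \<in> R k \<omega>) \<and>
    (\<forall>i\<in>{..<J}. \<exists>y\<in>crossing n (b - int n * int i). y \<in> R k \<omega>)}"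
    by (auto simp: hits_def)
  also have "\<dots> \<in> events" by measurable
  finally show ?thesis .
qed

text \<open>
  The sets of hyperedges across different points \<open>b - n i\<close> are disjoint, and each contains fewer
  than \<open>n\<close> positions. In the induction step the position that rings across the last point is moved
  into \<open>U\<close> by a union bound.
\<close>

lemma prob_hits:
  assumes A: "A \<in> sets (past M R k)" and "finite U"
    and "U \<inter> (\<Union>i<J. crossing n (b - int n * int i)) = {}"
  shows "prob (A \<inter> hits n k b J U) \<le> prob A * q ^ card U * (real n * q) ^ J"
  using assms(2,3)
proof (induction J arbitrary: U)
  case 0
  have "hits n k b 0 U = pattern k U {}" by (simp add: hits_def pattern_def)
  then show ?case using prob_past_pattern[OF A 0(1), of "{}"] by simp
next
  case (Suc J)
  define C where "C = crossing n (b - int n * int J)"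
  have Aev: "A \<in> events" using A past_events by blast
  have ev: "A \<inter> hits n k b J (insert y U) \<in> events" for y
    using Aev hits_events[of "insert y U"] Suc.prems by auto
  have each: "prob (A \<inter> hits n k b J (insert y U)) \<le> prob A * q ^ card U * (real n * q) ^ J * q"
    if "y \<in> C" for y
  proof -
    have "y \<notin> U" using that Suc.prems(2) unfolding C_def by blast
    have away: "y \<notin> crossing n (b - int n * int i)" if "i < J" for i
    proof -
      have "int n * (int i + 1) \<le> int n * int J"
        using that by (intro mult_left_mono) auto
      then show ?thesis
        using \<open>y \<in> C\<close> by (auto simp: C_def crossing_def algebra_simps)
    qed
    have "U \<inter> (\<Union>i<J. crossing n (b - int n * int i)) = {}"
      using Suc.prems(2) by (simp add: lessThan_Suc Int_Un_distrib)
    then have "insert y U \<inter> (\<Union>i<J. crossing n (b - int n * int i)) = {}"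
      using away by simp
    with \<open>y \<notin> U\<close> show ?thesis
      using Suc.IH[of "insert y U"] Suc.prems(1) by (simp add: mult_ac)
  qed
  have "A \<inter> hits n k b (Suc J) U \<subseteq> (\<Union>y\<in>C. A \<inter> hits n k b J (insert y U))"
  proof
    fix \<omega> assume \<omega>: "\<omega> \<in> A \<inter> hits n k b (Suc J) U"
    then obtain y where "y \<in> R k \<omega>" "y \<in> C"
      unfolding hits_def C_def by blast
    then show "\<omega> \<in> (\<Union>y\<in>C. A \<inter> hits n k b J (insert y U))"
      using \<omega> by (auto simp: hits_def)
  qed
  then have "prob (A \<inter> hits n k b (Suc J) U) \<le> prob (\<Union>y\<in>C. A \<inter> hits n k b J (insert y U))"
    by (intro finite_measure_mono sets.finite_UN ev) (simp_all add: C_def)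
  also have "\<dots> \<le> (\<Sum>y\<in>C. prob (A \<inter> hits n k b J (insert y U)))"
    by (intro finite_measure_subadditive_finite) (use ev in \<open>auto simp: C_def\<close>)
  also have "\<dots> \<le> (\<Sum>y\<in>C. prob A * q ^ card U * (real n * q) ^ J * q)"
    by (intro sum_mono each)
  also have "\<dots> = real (n - 1) * (prob A * q ^ card U * (real n * q) ^ J * q)"
    by (simp add: C_def card_crossing)
  also have "\<dots> \<le> real n * (prob A * q ^ card U * (real n * q) ^ J * q)"
    using q_bounds by (intro mult_right_mono) auto
  finally show ?case by (simp add: mult_ac)
qed

lemma AE_free_crossing:
  assumes "real n * q < 1"
  shows "AE \<omega> in M. \<forall>k b. \<exists>j\<ge>1. R k \<omega> \<inter> crossing n (b - int n * int j) = {}"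
proof -
  have "AE \<omega> in M. \<exists>j\<ge>1. R k \<omega> \<inter> crossing n (b - int n * int j) = {}" for k b
  proof -
    define B where "B = (\<Inter>J. hits n k (b - int n) J {})"
    have Bev: "B \<in> events" unfolding B_def using hits_events by auto
    have "prob B \<le> (real n * q) ^ J" for J
    proof -
      have "prob B \<le> prob (space M \<inter> hits n k (b - int n) J {})"
      proof (rule finite_measure_mono)
        show "B \<subseteq> space M \<inter> hits n k (b - int n) J {}"
          using sets.sets_into_space[OF Bev] unfolding B_def by blast
        show "space M \<inter> hits n k (b - int n) J {} \<in> events"
          using hits_events[of "{}"] by (intro sets.Int) auto
      qed
      also have "\<dots> \<le> prob (space M) * q ^ card ({} :: int set) * (real n * q) ^ J"
        by (rule prob_hits) (use sets.top[of "past M R k"] in auto)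
      finally show ?thesis by (simp add: prob_space)
    qed
    moreover have "(\<lambda>J. (real n * q) ^ J) \<longlonglongrightarrow> 0"
      using assms q_bounds by (intro LIMSEQ_realpow_zero) auto
    ultimately have "prob B \<le> 0" by (intro LIMSEQ_le_const) auto
    then have "prob B = 0" by (simp add: measure_le_0_iff)
    then have "AE \<omega> in M. \<omega> \<notin> B" using Bev by (simp add: prob_eq_0)
    then show ?thesis
    proof (rule AE_mp, intro AE_I2 impI)
      fix \<omega> assume "\<omega> \<in> space M" "\<omega> \<notin> B"
      then obtain i where "R k \<omega> \<inter> crossing n (b - int n - int n * int i) = {}"
        by (auto simp: B_def hits_def)
      then show "\<exists>j\<ge>1. R k \<omega> \<inter> crossing n (b - int n * int j) = {}"
        by (intro exI[of _ "Suc i"]) (simp add: algebra_simps)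
    qed
  qed
  then show ?thesis by (simp add: AE_all_countable)
qed

end

text \<open>
  The first-order effect of a step on \<open>E [exp (- \<theta> \<cdot> move)]\<close>: the sum over the hyperedges
  across the boundary, each ringing alone.
\<close>

definition drift :: "nat \<Rightarrow> real \<Rightarrow> real" where
  "drift n \<theta> = (\<Sum>y\<in>crossing n 0. exp (- \<theta> * real_of_int (ring_gain n 0 y)) - 1)"

text \<open>
  The factor \<open>(1 - q) ^ (3 * n)\<close> is the probability that the other \<open>3 * n\<close> hyperedges in the window
  do not ring. The term with \<open>q\<^sup>2\<close> bounds the contribution of the retreats: by one block when two
  hyperedges in the window ring, and by \<open>J \<ge> 2\<close> blocks when the points \<open>b - n i\<close> with \<open>i < J\<close> are all hit.
\<close>

definition step_factor :: "nat \<Rightarrow> real \<Rightarrow> real \<Rightarrow> real" where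
  "step_factor n \<theta> q = 1 + q * (1 - q) ^ (3 * n) * drift n \<theta> +
     q\<^sup>2 * (exp (\<theta> * n) * (3 * n + 1)\<^sup>2 + 2 * (exp (\<theta> * n) * n)\<^sup>2)"

lemma sum_exp_ring_gain:
  "(\<Sum>y\<in>crossing n b. exp (- \<theta> * real_of_int (ring_gain n b y))) = real (n - 1) + drift n \<theta>"
proof -
  have "crossing n b = (\<lambda>y. y + b) ` crossing n 0"
    by (force simp: crossing_def image_iff intro: bexI[of _ "_ - b"])
  then have "(\<Sum>y\<in>crossing n b. exp (- \<theta> * real_of_int (ring_gain n b y))) =
      (\<Sum>y\<in>crossing n 0. exp (- \<theta> * real_of_int (ring_gain n b (y + b))))"
    by (simp add: sum.reindex)
  also have "\<dots> = (\<Sum>y\<in>crossing n 0. exp (- \<theta> * real_of_int (ring_gain n 0 y)))"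
    by (intro sum.cong) (auto simp: ring_gain_def)
  also have "\<dots> = real (n - 1) + drift n \<theta>"
    by (simp add: drift_def sum_subtractf card_crossing)
  finally show ?thesis .
qed

context ring_field
begin

lemma measurable_right_move_past:
  "(\<lambda>\<omega>. right_move n (R k \<omega>) b) \<in> measurable (past M R (Suc k)) (count_space UNIV)"
  by (intro measurable_right_move ring_measurable_past) simp

text \<open>
  A pointwise bound by indicators of patterns, according to the cases of \<open>right_move\<close>. A
  retreat by \<open>J \<ge> 2\<close> blocks costs a factor \<open>exp (\<theta> n J)\<close> but has probability at most
  \<open>(n q)\<^sup>J\<close>, so these terms form a geometric series with ratio \<open>exp (\<theta> n) n q\<close>. The event \<open>A\<close> of the
  past is carried along so that the estimate can be iterated.
\<close>

lemma exp_right_move: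
  assumes A: "A \<in> sets (past M R k)" and small: "exp (\<theta> * n) * (n * q) \<le> 1 / 2"
  shows "(\<integral>\<^sup>+\<omega>. indicator A \<omega> * ennreal (exp (- \<theta> * real_of_int (right_move n (R k \<omega>) b))) \<partial>M)
    \<le> ennreal (prob A * step_factor n \<theta> q)"
proof -
  define W C where "W = window n b" and "C = crossing n b"
  have [simp]: "finite W" "finite C" "C \<subseteq> W" "card W = 3 * n + 1" "card C = n - 1"
    by (simp_all add: W_def C_def crossing_subset_window card_window card_crossing)
  define e where "e y = exp (- \<theta> * real_of_int (ring_gain n b y))" for y
  define s where "s = q * (1 - q) ^ (3 * n)"
  \<comment> \<open>\<open>S y\<close>: only \<open>y\<close> rings in the window; \<open>N\<close>: no single ring across the boundary;
    \<open>P\<close>: two rings in the window; \<open>H i\<close>: the first \<open>i + 2\<close> points are all hit\<close>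
  define S where "S y = A \<inter> pattern k {y} (W - {y})" for y
  define N where "N = A - (\<Union>y\<in>C. S y)"
  define D where "D = {p \<in> W \<times> W. fst p \<noteq> snd p}"
  define P where "P = (\<Union>p\<in>D. A \<inter> pattern k {fst p, snd p} {})"
  define H where "H i = A \<inter> hits n k b (i + 2) {}" for i
  define x where "x i = exp (\<theta> * n * (i + 2))" for i :: nat
  define r where "r = exp (\<theta> * n) * (n * q)"
  have D: "finite D" "card D \<le> (3 * n + 1)\<^sup>2"
    using card_mono[of "W \<times> W" D] by (auto simp: D_def card_cartesian_product power2_eq_square)
  have Aev [measurable]: "A \<in> events" using A past_events by blast
  have [measurable]: "S y \<in> events" for y
    unfolding S_def using pattern_events Aev by auto
  have [measurable]: "N \<in> events" unfolding N_def by auto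
  have [measurable]: "P \<in> events"
    unfolding P_def using pattern_events D(1) Aev by (intro sets.finite_UN sets.Int) auto
  have [measurable]: "H i \<in> events" for i
    unfolding H_def using hits_events[of "{}"] by auto
  have prS: "prob (S y) = prob A * s" if "y \<in> C" for y
  proof -
    have "y \<in> W" using that \<open>C \<subseteq> W\<close> by blast
    then have "card (W - {y}) = 3 * n" by simp
    then show ?thesis
      unfolding S_def s_def by (subst prob_past_pattern[OF A]) auto
  qed
  have prN: "prob N = prob A - prob A * s * real (n - 1)"
  proof -
    have "disjoint_family_on S C"
      unfolding disjoint_family_on_def
    proof (intro ballI impI)
      fix y z assume yz: "y \<in> C" "z \<in> C" "y \<noteq> z"
      then have "z \<in> W - {y}" using \<open>C \<subseteq> W\<close> by blast
      then show "S y \<inter> S z = {}" by (auto simp: S_def pattern_def)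
    qed
    then have "prob (\<Union>y\<in>C. S y) = (\<Sum>y\<in>C. prob (S y))"
      by (intro finite_measure_finite_Union) auto
    also have "\<dots> = prob A * s * real (n - 1)" by (simp add: prS)
    finally have "prob (\<Union>y\<in>C. S y) = prob A * s * real (n - 1)" .
    moreover have "(\<Union>y\<in>C. S y) \<in> events" "(\<Union>y\<in>C. S y) \<subseteq> A" by (auto simp: S_def[symmetric]) (simp add: S_def)
    ultimately show ?thesis
      unfolding N_def by (simp add: finite_measure_Diff)
  qed
  have prP: "prob P \<le> prob A * ((3 * n + 1)\<^sup>2 * q\<^sup>2)"
  proof -
    have "prob P \<le> (\<Sum>p\<in>D. prob (A \<inter> pattern k {fst p, snd p} {}))"
      unfolding P_def using pattern_events D(1) Aev
      by (intro finite_measure_subadditive_finite) auto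
    also have "\<dots> = (\<Sum>p\<in>D. prob A * q\<^sup>2)"
    proof (rule sum.cong)
      fix p assume "p \<in> D"
      then have "card {fst p, snd p} = 2" by (simp add: D_def)
      then show "prob (A \<inter> pattern k {fst p, snd p} {}) = prob A * q\<^sup>2"
        by (subst prob_past_pattern[OF A]) auto
    qed simp
    also have "\<dots> = real (card D) * (prob A * q\<^sup>2)" by simp
    also have "\<dots> \<le> real ((3 * n + 1)\<^sup>2) * (prob A * q\<^sup>2)"
      using D(2) by (intro mult_right_mono) (auto simp del: of_nat_power)
    finally show ?thesis by (simp add: mult_ac)
  qed
  have prH: "x i * prob (H i) \<le> prob A * r\<^sup>2 * r ^ i" for i
  proof -
    have "x i = exp (\<theta> * n) ^ (i + 2)"
      unfolding x_def exp_of_nat_mult[symmetric] by (simp add: mult_ac)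
    moreover have "prob (H i) \<le> prob A * (real n * q) ^ (i + 2)"
      unfolding H_def using prob_hits[OF A, of "{}" n b "i + 2"] by simp
    ultimately have "x i * prob (H i) \<le> exp (\<theta> * n) ^ (i + 2) * (prob A * (real n * q) ^ (i + 2))"
      by (intro mult_mono) auto
    also have "\<dots> = prob A * r\<^sup>2 * r ^ i"
      by (simp add: r_def power_mult_distrib power_add power2_eq_square)
    finally show ?thesis .
  qed
  have r: "0 \<le> r" "r \<le> 1 / 2" using small q_bounds by (auto simp: r_def)
  define T where "T \<omega> = indicator N \<omega> + (\<Sum>y\<in>C. ennreal (e y) * indicator (S y) \<omega>) +
      ennreal (exp (\<theta> * n)) * indicator P \<omega> + (\<Sum>i. ennreal (x i) * indicator (H i) \<omega>)" for \<omega>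
  have pointwise: "indicator A \<omega> * ennreal (exp (- \<theta> * real_of_int (right_move n (R k \<omega>) b))) \<le> T \<omega>"
    if "\<omega> \<in> space M" for \<omega>
  proof (cases "\<omega> \<in> A")
    case True
    have T1: "z \<le> T \<omega>" if "z \<le> indicator N \<omega>" for z
      unfolding T_def by (intro add_increasing2 that) auto
    have T2: "z \<le> T \<omega>" if "z \<le> (\<Sum>y\<in>C. ennreal (e y) * indicator (S y) \<omega>)" for z
      unfolding T_def by (intro add_increasing2 add_increasing[OF _ that]) auto
    have T3: "z \<le> T \<omega>" if "z \<le> ennreal (exp (\<theta> * n)) * indicator P \<omega>" for z
      unfolding T_def by (intro add_increasing2 add_increasing[OF _ that]) auto
    have T4: "z \<le> T \<omega>" if "z \<le> (\<Sum>i. ennreal (x i) * indicator (H i) \<omega>)" for z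
      unfolding T_def by (intro add_increasing[OF _ that]) auto
    have inS: "R k \<omega> \<inter> W = {y}" if "\<omega> \<in> S y" "y \<in> C" for y
      using that subsetD[OF \<open>C \<subseteq> W\<close>] by (auto simp: S_def pattern_def)
    show ?thesis
    proof (cases "R k \<omega> \<inter> C = {}")
      case noR: True
      then have "\<omega> \<in> N" using True inS \<open>C \<subseteq> W\<close> by (auto simp: N_def)
      then show ?thesis using True noR by (intro T1) (simp add: right_move_def C_def)
    next
      case hit: False
      show ?thesis
      proof (cases "\<exists>y. R k \<omega> \<inter> W = {y}")
        case single: True
        then obtain y where y: "R k \<omega> \<inter> W = {y}" by blast
        obtain w where "w \<in> R k \<omega>" "w \<in> C" using hit by blast
        then have "w \<in> R k \<omega> \<inter> W" using \<open>C \<subseteq> W\<close> by blast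
        then have "y \<in> C" using y \<open>w \<in> C\<close> by simp
        have "\<omega> \<in> S y" using y True that by (auto simp: S_def pattern_def)
        have "right_move n (R k \<omega>) b = ring_gain n b y"
          using hit y by (simp add: right_move_def C_def W_def)
        then have "indicator A \<omega> * ennreal (exp (- \<theta> * real_of_int (right_move n (R k \<omega>) b))) =
            ennreal (e y) * indicator (S y) \<omega>"
          using True \<open>\<omega> \<in> S y\<close> by (simp add: e_def)
        also have "\<dots> \<le> (\<Sum>y\<in>C. ennreal (e y) * indicator (S y) \<omega>)"
          using \<open>y \<in> C\<close> by (intro member_le_sum) auto
        finally show ?thesis by (rule T2)
      next
        case multi: False
        define J where "J = retreat n (R k \<omega>) b"
        have mv: "right_move n (R k \<omega>) b = - int n * int J"
          using hit multi by (simp add: right_move_def C_def W_def J_def)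
        consider "J = 0" | "J = 1" | "2 \<le> J" by linarith
        then show ?thesis
        proof cases
          case 1
          \<comment> \<open>the arbitrary value of \<open>retreat\<close> may be \<open>0\<close>; the boundary then stays put\<close>
          have "\<omega> \<in> N" using True multi inS by (auto simp: N_def)
          then show ?thesis using True mv 1 by (intro T1) simp
        next
          case 2
          obtain y where y: "y \<in> R k \<omega> \<inter> W" using hit \<open>C \<subseteq> W\<close> by blast
          then obtain z where z: "z \<in> R k \<omega> \<inter> W" "z \<noteq> y" using multi by blast
          have "\<omega> \<in> P"
            unfolding P_def using y z True that
            by (intro UN_I[of "(y, z)"]) (auto simp: D_def pattern_def)
          then show ?thesis using True mv 2 by (intro T3) simp
        next
          case 3
          \<comment> \<open>minimality of the retreat, and \<open>hit\<close> for \<open>i = 0\<close>\<close>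
          have "R k \<omega> \<inter> crossing n (b - int n * int i) \<noteq> {}" if "i < J" for i
            using that hit not_less_Least[of i "\<lambda>j. 1 \<le> j \<and> R k \<omega> \<inter> crossing n (b - int n * int j) = {}"]
            by (cases "i = 0") (auto simp: J_def retreat_def C_def)
          then have "\<omega> \<in> H (J - 2)" using 3 True that by (simp add: H_def hits_def)
          then have "indicator A \<omega> * ennreal (exp (- \<theta> * real_of_int (right_move n (R k \<omega>) b))) =
              ennreal (x (J - 2)) * indicator (H (J - 2)) \<omega>"
            using True mv 3 by (simp add: x_def of_nat_diff mult_ac)
          also have "\<dots> = (\<Sum>i\<in>{J - 2}. ennreal (x i) * indicator (H i) \<omega>)"
            by (subst sum.insert) auto
          also have "\<dots> \<le> (\<Sum>i. ennreal (x i) * indicator (H i) \<omega>)"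
            by (intro sum_le_suminf) auto
          finally show ?thesis by (rule T4)
        qed
      qed
    qed
  qed simp
  have T2: "(\<Sum>y\<in>C. ennreal (e y) * ennreal (prob (S y))) =
      ennreal (prob A * s * (real (n - 1) + drift n \<theta>))"
  proof -
    have "(\<Sum>y\<in>C. ennreal (e y) * ennreal (prob (S y))) = (\<Sum>y\<in>C. ennreal (e y * (prob A * s)))"
      by (intro sum.cong) (simp_all add: prS ennreal_mult' e_def)
    also have "\<dots> = ennreal (\<Sum>y\<in>C. e y * (prob A * s))"
      using q_bounds by (intro sum_ennreal) (auto simp: e_def s_def)
    also have "(\<Sum>y\<in>C. e y * (prob A * s)) = prob A * s * (\<Sum>y\<in>C. e y)"
      unfolding sum_distrib_left by (intro sum.cong) simp_all
    finally show ?thesis unfolding e_def C_def sum_exp_ring_gain .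
  qed
  have T3: "ennreal (exp (\<theta> * n)) * ennreal (prob P) \<le>
      ennreal (exp (\<theta> * n) * (prob A * ((3 * n + 1)\<^sup>2 * q\<^sup>2)))"
    unfolding ennreal_mult'[symmetric, OF less_imp_le[OF exp_gt_zero]]
    using prP by (intro ennreal_leI mult_left_mono) auto
  have T4: "(\<Sum>i. ennreal (x i) * ennreal (prob (H i))) \<le> ennreal (prob A * r\<^sup>2 * 2)"
  proof -
    have "(\<Sum>i. ennreal (x i) * ennreal (prob (H i))) \<le> (\<Sum>i. ennreal (prob A * r\<^sup>2 * r ^ i))"
    proof (intro suminf_le)
      fix i
      have "ennreal (x i) * ennreal (prob (H i)) = ennreal (x i * prob (H i))"
        by (simp add: ennreal_mult' x_def)
      then show "ennreal (x i) * ennreal (prob (H i)) \<le> ennreal (prob A * r\<^sup>2 * r ^ i)"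
        using prH[of i] by (simp add: ennreal_leI)
    qed auto
    also have "\<dots> = ennreal (prob A * r\<^sup>2 * (1 / (1 - r)))"
      using r by (intro suminf_ennreal_eq sums_mult geometric_sums) auto
    also have "\<dots> \<le> ennreal (prob A * r\<^sup>2 * 2)"
      using r by (intro ennreal_leI mult_left_mono) (auto simp: field_simps)
    finally show ?thesis .
  qed
  have "(\<integral>\<^sup>+\<omega>. indicator A \<omega> * ennreal (exp (- \<theta> * real_of_int (right_move n (R k \<omega>) b))) \<partial>M)
      \<le> (\<integral>\<^sup>+\<omega>. T \<omega> \<partial>M)"
    by (intro nn_integral_mono pointwise)
  also have "\<dots> = ennreal (prob N) + (\<Sum>y\<in>C. ennreal (e y) * ennreal (prob (S y))) +
      ennreal (exp (\<theta> * n)) * ennreal (prob P) + (\<Sum>i. ennreal (x i) * ennreal (prob (H i)))"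
    unfolding T_def
    by (simp add: nn_integral_add nn_integral_sum nn_integral_suminf nn_integral_cmult_indicator
        emeasure_eq_measure del: sum_mult_indicator)
  also have "\<dots> \<le> ennreal (prob N) + ennreal (prob A * s * (real (n - 1) + drift n \<theta>)) +
      ennreal (exp (\<theta> * n) * (prob A * ((3 * n + 1)\<^sup>2 * q\<^sup>2))) + ennreal (prob A * r\<^sup>2 * 2)"
    unfolding T2 by (intro add_mono T3 T4 order_refl)
  also have "\<dots> = ennreal (prob A * step_factor n \<theta> q)"
  proof -
    have "0 \<le> real (n - 1) + drift n \<theta>"
      unfolding sum_exp_ring_gain[where b = 0, symmetric] by (intro sum_nonneg) simp
    then have "0 \<le> prob A * s * (real (n - 1) + drift n \<theta>)"
      using q_bounds by (simp add: s_def)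
    then show ?thesis
      by (simp add: ennreal_plus[symmetric] del: ennreal_plus)
        (simp add: prN step_factor_def s_def r_def power_mult_distrib algebra_simps)
  qed
  finally show ?thesis .
qed

end

section \<open>The random walk of a boundary\<close>

text \<open>
  With \<open>m = n div 2\<close>, the gains \<open>1, \<dots>, m - 1\<close> cancel against the losses \<open>1, \<dots>, m - 1\<close>. What remains is
  the gain \<open>m\<close> of the tie, when the hyperedge covers exactly \<open>m\<close> ones.
\<close>

lemma sum_ring_gain:
  assumes "even n" "n \<ge> 2"
  shows "(\<Sum>y\<in>crossing n 0. ring_gain n 0 y) = int (n div 2)"
proof -
  define m where "m = int (n div 2)"
  have n: "int n = 2 * m" and "0 < m" using assms by (auto simp: m_def)
  have "crossing n 0 = insert (- m) ({- 2 * m<..<- m} \<union> {- m<..<0})"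
    using \<open>0 < m\<close> by (auto simp: crossing_def n)
  then have "(\<Sum>y\<in>crossing n 0. ring_gain n 0 y) = ring_gain n 0 (- m) +
      ((\<Sum>y\<in>{- 2 * m<..<- m}. ring_gain n 0 y) + (\<Sum>y\<in>{- m<..<0}. ring_gain n 0 y))"
    by (simp, subst sum.union_disjoint) auto
  also have "(\<Sum>y\<in>{- 2 * m<..<- m}. ring_gain n 0 y) = (\<Sum>y\<in>{- m<..<0}. - y)"
    by (rule sum.reindex_bij_witness[of _ "\<lambda>y. - 2 * m - y" "\<lambda>y. - 2 * m - y"])
      (auto simp: ring_gain_def n)
  also have "(\<Sum>y\<in>{- m<..<0}. ring_gain n 0 y) = (\<Sum>y\<in>{- m<..<0}. y)"
    by (intro sum.cong) (auto simp: ring_gain_def n)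
  finally show ?thesis
    by (simp add: ring_gain_def n m_def sum_negf)
qed

text \<open>
  The function \<open>drift n\<close> vanishes at \<open>0\<close>, and its derivative there is minus the mean move.
\<close>

lemma drift_negative:
  assumes "even n" "n \<ge> 2"
  obtains \<theta> where "\<theta> > 0" "drift n \<theta> < 0"
proof -
  have "(drift n has_real_derivative - real_of_int (\<Sum>y\<in>crossing n 0. ring_gain n 0 y)) (at 0)"
    unfolding drift_def by (auto intro!: derivative_eq_intros simp: sum_negf)
  moreover have "- real_of_int (\<Sum>y\<in>crossing n 0. ring_gain n 0 y) < 0"
    using assms by (simp add: sum_ring_gain)
  ultimately obtain d where d: "d > 0" "\<And>h. 0 < h \<Longrightarrow> h < d \<Longrightarrow> drift n (0 + h) < drift n 0"
    using DERIV_neg_dec_right by blast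
  have "drift n 0 = 0" by (simp add: drift_def)
  with d(2)[of "d / 2"] d(1) show ?thesis by (intro that[of "d / 2"]) auto
qed

text \<open>
  The term of order \<open>q\<close> is negative and dominates the term of order \<open>q\<^sup>2\<close> for small \<open>q\<close>. The bound is
  uniform on an interval of \<open>q\<close> because the step length will have to vary with time.
\<close>

lemma step_factor_contracts:
  assumes "n \<ge> 2" and neg: "drift n \<theta> < 0"
  obtains q\<^sub>1 :: real where "0 < q\<^sub>1" "q\<^sub>1 < 1"
    "\<forall>q\<in>{0..q\<^sub>1}. exp (\<theta> * n) * (n * q) \<le> 1 / 2 \<and> n * q < 1 \<and>
      step_factor n \<theta> q \<le> 1 + q * drift n \<theta> / 4"
proof -
  define K where "K = exp (\<theta> * n) * (3 * n + 1)\<^sup>2 + 2 * (exp (\<theta> * n) * n)\<^sup>2"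
  have "K > 0" unfolding K_def by (intro add_pos_nonneg mult_pos_pos) auto
  \<comment> \<open>the three bounds give \<open>(1 - q) ^ (3 * n) \<ge> 1 / 2\<close>, a geometric ratio of at most \<open>1 / 2\<close>,
    and \<open>K * q \<le> - drift n \<theta> / 4\<close>\<close>
  define q\<^sub>1 where "q\<^sub>1 = min (1 / (6 * n)) (min (1 / (2 * n * exp (\<theta> * n))) (- drift n \<theta> / (4 * K)))"
  show ?thesis
  proof (rule that[of q\<^sub>1])
    show "0 < q\<^sub>1" using neg \<open>K > 0\<close> assms by (simp add: q\<^sub>1_def divide_neg_pos)
    have "1 / (6 * real n) < 1" using assms by (simp add: field_simps)
    then show "q\<^sub>1 < 1" by (simp add: q\<^sub>1_def)
    show "\<forall>q\<in>{0..q\<^sub>1}. exp (\<theta> * n) * (n * q) \<le> 1 / 2 \<and> n * q < 1 \<and>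
      step_factor n \<theta> q \<le> 1 + q * drift n \<theta> / 4"
    proof (intro ballI conjI)
      fix q :: real assume "q \<in> {0..q\<^sub>1}"
      then have q: "0 \<le> q" "q \<le> q\<^sub>1" by auto
      then have q1: "q \<le> 1 / (6 * n)" and q2: "q \<le> 1 / (2 * n * exp (\<theta> * n))"
        and q3: "q \<le> - drift n \<theta> / (4 * K)"
        by (auto simp: q\<^sub>1_def)
      show "exp (\<theta> * n) * (n * q) \<le> 1 / 2"
        using q2 assms by (simp add: field_simps)
      have nq: "n * q \<le> 1 / 6" using q1 assms by (simp add: field_simps)
      then show "n * q < 1" by simp
      have "1 + real (3 * n) * (- q) \<le> (1 + (- q)) ^ (3 * n)"
        using q1 \<open>1 / (6 * real n) < 1\<close> by (intro Bernoulli_inequality) linarith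
      then have "1 / 2 \<le> (1 - q) ^ (3 * n)" using nq by simp
      then have "q * (1 - q) ^ (3 * n) * drift n \<theta> \<le> q * (1 / 2) * drift n \<theta>"
        using q neg by (intro mult_right_mono_neg mult_left_mono) auto
      moreover have "q * (q * K) \<le> q * (- drift n \<theta> / 4)"
        using q q3 \<open>K > 0\<close> by (intro mult_left_mono) (auto simp: field_simps)
      ultimately show "step_factor n \<theta> q \<le> 1 + q * drift n \<theta> / 4"
        unfolding step_factor_def K_def[symmetric] by (simp add: power2_eq_square mult.assoc)
    qed
  qed
qed

primrec right_edge :: "nat \<Rightarrow> (nat \<Rightarrow> int set) \<Rightarrow> int \<Rightarrow> nat \<Rightarrow> int" where
  "right_edge n S b 0 = b"
| "right_edge n S b (Suc k) = right_edge n S b k + right_move n (S k) (right_edge n S b k)"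

definition left_edge :: "nat \<Rightarrow> (nat \<Rightarrow> int set) \<Rightarrow> int \<Rightarrow> nat \<Rightarrow> int" where
  "left_edge n S a k = - right_edge n (\<lambda>j. mirror_rings n (S j)) (- a) k"

lemma left_edge_0: "left_edge n S a 0 = a"
  by (simp add: left_edge_def)

lemma left_edge_Suc: "left_edge n S a (Suc k) = left_edge n S a k + left_move n (S k) (left_edge n S a k)"
  by (simp add: left_edge_def left_move_def)

lemma past_measurable_mono:
  "k \<le> l \<Longrightarrow> f \<in> measurable (past M R k) N \<Longrightarrow> f \<in> measurable (past M R l) N"
  using past_mono[of k l M R] by (auto simp: measurable_def)

lemma nn_integral_partition_int:
  fixes g :: "'w \<Rightarrow> int"
  assumes [measurable]: "A \<in> sets M" "g \<in> measurable M (count_space UNIV)"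
    and [measurable]: "\<And>c. F c \<in> borel_measurable M"
  shows "(\<integral>\<^sup>+\<omega>. indicator A \<omega> * F (g \<omega>) \<omega> \<partial>M) =
    (\<Sum>i. \<integral>\<^sup>+\<omega>. indicator (A \<inter> {\<omega> \<in> space M. g \<omega> = int_decode i}) \<omega> * F (int_decode i) \<omega> \<partial>M)"
proof -
  have "(\<integral>\<^sup>+\<omega>. indicator A \<omega> * F (g \<omega>) \<omega> \<partial>M) = (\<integral>\<^sup>+\<omega>. (\<Sum>i.
      indicator (A \<inter> {\<omega> \<in> space M. g \<omega> = int_decode i}) \<omega> * F (int_decode i) \<omega>) \<partial>M)"
  proof (rule nn_integral_cong)
    fix \<omega> assume "\<omega> \<in> space M"
    then show "indicator A \<omega> * F (g \<omega>) \<omega> =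
        (\<Sum>i. indicator (A \<inter> {\<omega> \<in> space M. g \<omega> = int_decode i}) \<omega> * F (int_decode i) \<omega>)"
      by (subst suminf_finite[of "{int_encode (g \<omega>)}"]) (auto simp: indicator_def)
  qed
  also have "\<dots> = (\<Sum>i. \<integral>\<^sup>+\<omega>. indicator (A \<inter> {\<omega> \<in> space M. g \<omega> = int_decode i}) \<omega> * F (int_decode i) \<omega> \<partial>M)"
    by (rule nn_integral_suminf) measurable
  finally show ?thesis .
qed

context ring_field
begin

lemma measurable_right_edge:
  "(\<lambda>\<omega>. right_edge n (\<lambda>j. R (s + j) \<omega>) b k) \<in> measurable (past M R (s + k)) (count_space UNIV)"
proof (induction k)
  case (Suc k)
  then have [measurable]: "(\<lambda>\<omega>. right_edge n (\<lambda>j. R (s + j) \<omega>) b k) \<in>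
      measurable (past M R (Suc (s + k))) (count_space UNIV)"
    by (rule past_measurable_mono[rotated]) simp
  have "(\<lambda>\<omega>. c + right_move n (R (s + k) \<omega>) c) \<in> measurable (past M R (Suc (s + k))) (count_space UNIV)" for c
    using measurable_right_move_past by measurable
  then show ?case
    using measurable_compose_countable[where g = "\<lambda>\<omega>. right_edge n (\<lambda>j. R (s + j) \<omega>) b k"
        and f = "\<lambda>c \<omega>. c + right_move n (R (s + k) \<omega>) c"]
    by simp
qed simp

lemma measurable_right_edge_M:
  "(\<lambda>\<omega>. right_edge n (\<lambda>j. R (s + j) \<omega>) b k) \<in> measurable M (count_space UNIV)"
  by (rule past_measurableD[OF measurable_right_edge])

text \<open>
  Each step multiplies the exponential moment by at most \<open>\<rho>\<close>: decompose according to the current position of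
  the boundary, which belongs to the past of the step, and apply the bound for a fixed position.
\<close>

lemma exp_right_edge:
  assumes A: "A \<in> sets (past M R s)" and small: "exp (\<theta> * n) * (n * q) \<le> 1 / 2"
    and \<rho>: "step_factor n \<theta> q \<le> \<rho>" "0 \<le> \<rho>"
  shows "(\<integral>\<^sup>+\<omega>. indicator A \<omega> *
      ennreal (exp (- \<theta> * real_of_int (right_edge n (\<lambda>j. R (s + j) \<omega>) b k - b))) \<partial>M)
    \<le> ennreal (\<rho> ^ k * prob A)"
proof (induction k)
  case 0
  have "A \<in> events" using A past_events by blast
  then show ?case by (simp add: emeasure_eq_measure)
next
  case (Suc k)
  have Aev [measurable]: "A \<in> events" using A past_events by blast
  define g where "g \<omega> = right_edge n (\<lambda>j. R (s + j) \<omega>) b k" for \<omega>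
  have g: "g \<in> measurable (past M R (s + k)) (count_space UNIV)"
    unfolding g_def by (rule measurable_right_edge)
  have [measurable]: "g \<in> measurable M (count_space UNIV)" by (rule past_measurableD[OF g])
  have [measurable]: "(\<lambda>\<omega>. right_move n (R (s + k) \<omega>) c) \<in> measurable M (count_space UNIV)" for c
    by (rule past_measurableD[OF measurable_right_move_past])
  define w where "w c = exp (- \<theta> * real_of_int (c - b))" for c
  define B where "B i = A \<inter> {\<omega> \<in> space M. g \<omega> = int_decode i}" for i
  have B: "B i \<in> sets (past M R (s + k))" for i
  proof -
    have "g -` {int_decode i} \<inter> space (past M R (s + k)) \<in> sets (past M R (s + k))"
      using g by (rule measurable_sets) simp
    moreover have "A \<in> sets (past M R (s + k))" using A past_mono[of s "s + k" M R] by auto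
    moreover have "B i = A \<inter> (g -` {int_decode i} \<inter> space (past M R (s + k)))"
      by (auto simp: B_def)
    ultimately show ?thesis by auto
  qed
  have Bev [measurable]: "B i \<in> events" for i using B past_events by blast
  have "(\<integral>\<^sup>+\<omega>. indicator A \<omega> *
      ennreal (exp (- \<theta> * real_of_int (right_edge n (\<lambda>j. R (s + j) \<omega>) b (Suc k) - b))) \<partial>M) =
    (\<integral>\<^sup>+\<omega>. indicator A \<omega> * (ennreal (w (g \<omega>)) *
      ennreal (exp (- \<theta> * real_of_int (right_move n (R (s + k) \<omega>) (g \<omega>))))) \<partial>M)"
    by (intro nn_integral_cong)
      (simp add: g_def w_def ennreal_mult'[symmetric] exp_add[symmetric] algebra_simps)
  also have "\<dots> = (\<Sum>i. \<integral>\<^sup>+\<omega>. indicator (B i) \<omega> * (ennreal (w (int_decode i)) *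
      ennreal (exp (- \<theta> * real_of_int (right_move n (R (s + k) \<omega>) (int_decode i))))) \<partial>M)"
    unfolding B_def by (rule nn_integral_partition_int) measurable
  also have "\<dots> = (\<Sum>i. ennreal (w (int_decode i)) * (\<integral>\<^sup>+\<omega>. indicator (B i) \<omega> *
      ennreal (exp (- \<theta> * real_of_int (right_move n (R (s + k) \<omega>) (int_decode i)))) \<partial>M))"
    by (subst nn_integral_cmult[symmetric]) (auto simp: mult_ac)
  also have "\<dots> \<le> (\<Sum>i. ennreal \<rho> * (\<integral>\<^sup>+\<omega>. indicator (B i) \<omega> * ennreal (w (int_decode i)) \<partial>M))"
  proof (rule suminf_le)
    fix i
    have "(\<integral>\<^sup>+\<omega>. indicator (B i) \<omega> *
        ennreal (exp (- \<theta> * real_of_int (right_move n (R (s + k) \<omega>) (int_decode i)))) \<partial>M)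
      \<le> ennreal (prob (B i) * step_factor n \<theta> q)"
      by (rule exp_right_move[OF B small])
    also have "\<dots> \<le> ennreal (prob (B i) * \<rho>)"
      using \<rho> by (intro ennreal_leI mult_left_mono) auto
    also have "\<dots> = ennreal \<rho> * emeasure M (B i)"
      using \<rho> by (simp add: emeasure_eq_measure ennreal_mult' mult.commute)
    finally have "ennreal (w (int_decode i)) * (\<integral>\<^sup>+\<omega>. indicator (B i) \<omega> *
        ennreal (exp (- \<theta> * real_of_int (right_move n (R (s + k) \<omega>) (int_decode i)))) \<partial>M)
      \<le> ennreal (w (int_decode i)) * (ennreal \<rho> * emeasure M (B i))"
      by (rule mult_left_mono) simp
    also have "\<dots> = ennreal \<rho> * (\<integral>\<^sup>+\<omega>. indicator (B i) \<omega> * ennreal (w (int_decode i)) \<partial>M)"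
      by (subst (2) mult.commute) (simp add: nn_integral_cmult_indicator mult_ac)
    finally show "ennreal (w (int_decode i)) * (\<integral>\<^sup>+\<omega>. indicator (B i) \<omega> *
        ennreal (exp (- \<theta> * real_of_int (right_move n (R (s + k) \<omega>) (int_decode i)))) \<partial>M)
      \<le> ennreal \<rho> * (\<integral>\<^sup>+\<omega>. indicator (B i) \<omega> * ennreal (w (int_decode i)) \<partial>M)" .
  qed auto
  also have "\<dots> = ennreal \<rho> * (\<Sum>i. \<integral>\<^sup>+\<omega>. indicator (B i) \<omega> * ennreal (w (int_decode i)) \<partial>M)"
    by simp
  also have "(\<Sum>i. \<integral>\<^sup>+\<omega>. indicator (B i) \<omega> * ennreal (w (int_decode i)) \<partial>M) =
      (\<integral>\<^sup>+\<omega>. indicator A \<omega> * ennreal (w (g \<omega>)) \<partial>M)"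
    unfolding B_def by (rule nn_integral_partition_int[symmetric]) measurable
  also have "\<dots> \<le> ennreal (\<rho> ^ k * prob A)"
    using Suc.IH by (simp add: w_def g_def)
  also have "ennreal \<rho> * ennreal (\<rho> ^ k * prob A) = ennreal (\<rho> ^ Suc k * prob A)"
    using \<rho> by (simp add: ennreal_mult'[symmetric] mult_ac)
  finally show ?case by (simp add: mult_left_mono)
qed

lemma prob_right_edge_le:
  assumes A: "A \<in> sets (past M R s)" and small: "exp (\<theta> * n) * (n * q) \<le> 1 / 2"
    and \<rho>: "step_factor n \<theta> q \<le> \<rho>" "0 \<le> \<rho>" and "0 \<le> \<theta>"
  shows "prob (A \<inter> {\<omega> \<in> space M. right_edge n (\<lambda>j. R (s + j) \<omega>) b k \<le> b - d})
    \<le> exp (- \<theta> * d) * \<rho> ^ k * prob A"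
proof -
  have [measurable]: "A \<in> events" using A past_events by blast
  define g where "g \<omega> = right_edge n (\<lambda>j. R (s + j) \<omega>) b k" for \<omega>
  have [measurable]: "g \<in> measurable M (count_space UNIV)"
    unfolding g_def by (rule measurable_right_edge_M)
  define E where "E = A \<inter> {\<omega> \<in> space M. g \<omega> \<le> b - d}"
  have [measurable]: "E \<in> events" unfolding E_def by measurable
  have "ennreal (exp (\<theta> * d)) * emeasure M E = (\<integral>\<^sup>+\<omega>. ennreal (exp (\<theta> * d)) * indicator E \<omega> \<partial>M)"
    by (simp add: nn_integral_cmult_indicator)
  also have "\<dots> \<le> (\<integral>\<^sup>+\<omega>. indicator A \<omega> * ennreal (exp (- \<theta> * real_of_int (g \<omega> - b))) \<partial>M)"
  proof (intro nn_integral_mono)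
    fix \<omega>
    show "ennreal (exp (\<theta> * d)) * indicator E \<omega> \<le>
        indicator A \<omega> * ennreal (exp (- \<theta> * real_of_int (g \<omega> - b)))"
    proof (cases "\<omega> \<in> E")
      case True
      then have "real_of_int d \<le> - real_of_int (g \<omega> - b)" by (simp add: E_def)
      then have "\<theta> * d \<le> \<theta> * - real_of_int (g \<omega> - b)"
        using \<open>0 \<le> \<theta>\<close> by (rule mult_left_mono)
      then show ?thesis using True by (simp add: E_def ennreal_leI algebra_simps)
    qed simp
  qed
  also have "\<dots> \<le> ennreal (\<rho> ^ k * prob A)"
    unfolding g_def by (rule exp_right_edge[OF A small \<rho>])
  finally have "exp (\<theta> * d) * prob E \<le> \<rho> ^ k * prob A"
    using \<rho> by (simp add: emeasure_eq_measure ennreal_mult'[symmetric])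
  then show ?thesis
    unfolding E_def g_def by (simp add: exp_minus field_simps)
qed

end

lemma geometric_sum_le:
  fixes \<rho> :: real
  assumes "0 \<le> \<rho>" "\<rho> < 1"
  shows "(\<Sum>k\<le>K. \<rho> ^ k) \<le> 1 / (1 - \<rho>)"
proof -
  have "(\<Sum>k\<le>K. \<rho> ^ k) \<le> (\<Sum>k. \<rho> ^ k)"
    using assms by (intro sum_le_suminf summable_geometric) auto
  then show ?thesis using assms by (simp add: suminf_geometric)
qed

section \<open>Growth out of a majority hyperedge\<close>

text \<open>
  All hyperedges that meet the interval obtained from the hyperedge at \<open>x\<close> after \<open>G\<close> extensions by
  \<open>n div 2\<close> vertices.
\<close>

definition growth_window :: "nat \<Rightarrow> nat \<Rightarrow> int \<Rightarrow> int set" where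
  "growth_window n G x = {x - int n<..<x + int n + int G * int (n div 2)}"

lemma finite_growth_window [simp]: "finite (growth_window n G x)"
  by (simp add: growth_window_def)

lemma card_growth_window: "card (growth_window n G x) = 2 * n + G * (n div 2) - 1"
proof -
  have "x + int n + int G * int (n div 2) - (x - int n + 1) = int (2 * n + G * (n div 2)) - 1"
    by simp
  then show ?thesis
    unfolding growth_window_def card_greaterThanLessThan_int by (simp only:)
qed

lemma growth_site_in_window:
  assumes "n \<ge> 2" "g \<le> G"
  shows "x + int g * int (n div 2) \<in> growth_window n G x"
proof -
  have "int g * int (n div 2) \<le> int G * int (n div 2)"
    using assms by (intro mult_right_mono) auto
  moreover have "0 \<le> int g * int (n div 2)" by simp
  moreover have "0 < int n" using assms by simp
  ultimately show ?thesis
    unfolding growth_window_def greaterThanLessThan_iff by linarith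
qed

context ring_field
begin

lemma prob_right_edge_ever_le:
  assumes A: "A \<in> sets (past M R s)" and small: "exp (\<theta> * n) * (n * q) \<le> 1 / 2"
    and \<rho>: "step_factor n \<theta> q \<le> \<rho>" "0 \<le> \<rho>" "\<rho> < 1" and "0 \<le> \<theta>"
  shows "prob (A \<inter> {\<omega> \<in> space M. \<exists>k\<le>K. right_edge n (\<lambda>j. R (s + j) \<omega>) b k \<le> b - d})
    \<le> exp (- \<theta> * d) / (1 - \<rho>) * prob A"
proof -
  have [measurable]: "A \<in> events" using A past_events by blast
  note measurable_right_edge_M [measurable]
  have "prob (A \<inter> {\<omega> \<in> space M. \<exists>k\<le>K. right_edge n (\<lambda>j. R (s + j) \<omega>) b k \<le> b - d}) =
      prob (\<Union>k\<in>{..K}. A \<inter> {\<omega> \<in> space M. right_edge n (\<lambda>j. R (s + j) \<omega>) b k \<le> b - d})"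
    by (intro arg_cong[where f = prob]) auto
  also have "\<dots> \<le> (\<Sum>k\<le>K. prob (A \<inter> {\<omega> \<in> space M. right_edge n (\<lambda>j. R (s + j) \<omega>) b k \<le> b - d}))"
  proof (rule finite_measure_subadditive_finite)
    have "A \<inter> {\<omega> \<in> space M. right_edge n (\<lambda>j. R (s + j) \<omega>) b k \<le> b - d} \<in> events" for k
      by measurable
    then show "(\<lambda>k. A \<inter> {\<omega> \<in> space M. right_edge n (\<lambda>j. R (s + j) \<omega>) b k \<le> b - d}) ` {..K} \<subseteq> events"
      by blast
  qed simp
  also have "\<dots> \<le> (\<Sum>k\<le>K. exp (- \<theta> * d) * \<rho> ^ k * prob A)"
    by (intro sum_mono prob_right_edge_le[OF A small \<rho>(1,2) \<open>0 \<le> \<theta>\<close>])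
  also have "\<dots> = exp (- \<theta> * d) * prob A * (\<Sum>k\<le>K. \<rho> ^ k)"
    unfolding sum_distrib_left by (intro sum.cong) simp_all
  also have "\<dots> \<le> exp (- \<theta> * d) * prob A * (1 / (1 - \<rho>))"
    using geometric_sum_le[OF \<rho>(2,3)] by (intro mult_left_mono) auto
  finally show ?thesis by simp
qed

lemma prob_right_edge_bad:
  assumes A: "A \<in> sets (past M R s)" and small: "exp (\<theta> * n) * (n * q) \<le> 1 / 2"
    and \<rho>: "step_factor n \<theta> q \<le> \<rho>" "0 \<le> \<rho>" "\<rho> < 1" and "0 \<le> \<theta>"
    and z: "real_of_int (z - b) \<le> B"
  shows "prob (A \<inter> {\<omega> \<in> space M. (\<exists>k\<le>K. right_edge n (\<lambda>j. R (s + j) \<omega>) b k \<le> b - d) \<or>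
      right_edge n (\<lambda>j. R (s + j) \<omega>) b K \<le> z})
    \<le> (exp (- \<theta> * d) / (1 - \<rho>) + exp (\<theta> * B) * \<rho> ^ K) * prob A"
proof -
  have [measurable]: "A \<in> events" using A past_events by blast
  note measurable_right_edge_M [measurable]
  define E where "E = A \<inter> {\<omega> \<in> space M. \<exists>k\<le>K. right_edge n (\<lambda>j. R (s + j) \<omega>) b k \<le> b - d}"
  define F where "F = A \<inter> {\<omega> \<in> space M. right_edge n (\<lambda>j. R (s + j) \<omega>) b K \<le> b - (b - z)}"
  have [measurable]: "E \<in> events" "F \<in> events" unfolding E_def F_def by measurable
  have "A \<inter> {\<omega> \<in> space M. (\<exists>k\<le>K. right_edge n (\<lambda>j. R (s + j) \<omega>) b k \<le> b - d) \<or>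
      right_edge n (\<lambda>j. R (s + j) \<omega>) b K \<le> z} = E \<union> F"
    by (auto simp: E_def F_def)
  moreover have "prob (E \<union> F) \<le> prob E + prob F"
    by (rule measure_Un_le) measurable
  moreover have "prob E \<le> exp (- \<theta> * d) / (1 - \<rho>) * prob A"
    unfolding E_def by (rule prob_right_edge_ever_le[OF A small \<rho> \<open>0 \<le> \<theta>\<close>])
  moreover have "prob F \<le> exp (\<theta> * B) * \<rho> ^ K * prob A"
  proof -
    have "prob F \<le> exp (- \<theta> * real_of_int (b - z)) * \<rho> ^ K * prob A"
      unfolding F_def by (rule prob_right_edge_le[OF A small \<rho>(1,2) \<open>0 \<le> \<theta>\<close>])
    also have "\<theta> * real_of_int (z - b) \<le> \<theta> * B"
      using z \<open>0 \<le> \<theta>\<close> by (rule mult_left_mono)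
    then have "exp (- \<theta> * real_of_int (b - z)) * \<rho> ^ K * prob A \<le> exp (\<theta> * B) * \<rho> ^ K * prob A"
      using \<rho> by (intro mult_right_mono) (auto simp: algebra_simps)
    finally show ?thesis .
  qed
  ultimately show ?thesis by (simp add: distrib_right)
qed

lemma prob_left_edge_bad:
  assumes A: "A \<in> sets (past M R s)" and small: "exp (\<theta> * n) * (n * q) \<le> 1 / 2"
    and \<rho>: "step_factor n \<theta> q \<le> \<rho>" "0 \<le> \<rho>" "\<rho> < 1" and "0 \<le> \<theta>"
    and z: "real_of_int (a - z) \<le> B"
  shows "prob (A \<inter> {\<omega> \<in> space M. (\<exists>k\<le>K. a + d \<le> left_edge n (\<lambda>j. R (s + j) \<omega>) a k) \<or>
      z < left_edge n (\<lambda>j. R (s + j) \<omega>) a K})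
    \<le> (exp (- \<theta> * d) / (1 - \<rho>) + exp (\<theta> * B) * \<rho> ^ K) * prob A"
proof -
  interpret mirror: ring_field M "\<lambda>k \<omega>. mirror_rings n (R k \<omega>)" q
    by (rule mirror_ring_field)
  have A': "A \<in> sets (past M (\<lambda>k \<omega>. mirror_rings n (R k \<omega>)) s)"
    using A by (simp add: past_mirror)
  have "prob (A \<inter> {\<omega> \<in> space M. (\<exists>k\<le>K. a + d \<le> left_edge n (\<lambda>j. R (s + j) \<omega>) a k) \<or>
      z < left_edge n (\<lambda>j. R (s + j) \<omega>) a K}) =
    prob (A \<inter> {\<omega> \<in> space M.
      (\<exists>k\<le>K. right_edge n (\<lambda>j. mirror_rings n (R (s + j) \<omega>)) (- a) k \<le> - a - d) \<or>
      right_edge n (\<lambda>j. mirror_rings n (R (s + j) \<omega>)) (- a) K \<le> - z - 1})"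
    by (intro arg_cong[where f = prob] arg_cong2[where f = "(\<inter>)"] refl Collect_cong conj_cong
        disj_cong ex_cong) (auto simp: left_edge_def)
  also have "\<dots> \<le> (exp (- \<theta> * d) / (1 - \<rho>) + exp (\<theta> * B) * \<rho> ^ K) * prob A"
    by (rule mirror.prob_right_edge_bad[OF A' small \<rho> \<open>0 \<le> \<theta>\<close>]) (use z in simp)
  finally show ?thesis .
qed

text \<open>
  In step \<open>0\<close> the hyperedge at \<open>x\<close> itself rings and becomes full. In each later step the
  hyperedge with \<open>n div 2\<close> vertices beyond the right boundary rings, which for even \<open>n\<close> is a tie and
  extends the interval. Nothing else rings nearby.
\<close>

definition growth_event :: "nat \<Rightarrow> nat \<Rightarrow> int \<Rightarrow> 'w set" where
  "growth_event n G x = {\<omega> \<in> space M. \<forall>g\<le>G.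
     R g \<omega> \<inter> growth_window n G x = {x + int g * int (n div 2)}}"

lemma growth_event_eq:
  assumes "n \<ge> 2"
  shows "growth_event n G x = (\<Inter>g\<le>G. pattern g {x + int g * int (n div 2)}
    (growth_window n G x - {x + int g * int (n div 2)}))"
  using growth_site_in_window[OF assms] by (auto simp: growth_event_def pattern_def)

lemma growth_event_in_ring_algebra:
  assumes "n \<ge> 2"
  shows "growth_event n G x \<in> sets (ring_algebra M R ({..G} \<times> growth_window n G x))"
  unfolding growth_event_eq[OF assms]
  using growth_site_in_window[OF assms] by (intro sets.finite_INT pattern_in_ring_algebra) auto

lemma growth_event_past:
  assumes "n \<ge> 2"
  shows "growth_event n G x \<in> sets (past M R (Suc G))"
proof -
  have "{..G} \<times> growth_window n G x \<subseteq> {..<Suc G} \<times> UNIV" by auto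
  from ring_algebra_mono[OF this] show ?thesis
    using growth_event_in_ring_algebra[OF assms] unfolding past_def by (rule subsetD)
qed

lemma prob_growth_event:
  assumes "n \<ge> 2"
  shows "prob (growth_event n G x) = (q * (1 - q) ^ (2 * n + G * (n div 2) - 2)) ^ Suc G"
proof -
  define W where "W = growth_window n G x"
  define y where "y g = x + int g * int (n div 2)" for g
  have y: "y g \<in> W" if "g \<le> G" for g
    using growth_site_in_window[OF assms that] by (simp add: W_def y_def)
  have cardW: "card W = 2 * n + G * (n div 2) - 1"
    by (simp add: W_def card_growth_window)
  define A where "A j = space M \<inter> (\<Inter>g<j. pattern g {y g} (W - {y g}))" for j
  have A: "A j \<in> sets (past M R j)" for j
    unfolding A_def
    by (cases "j = 0") (use sets.top[of "past M R j"] in \<open>auto intro!: sets.Int sets.finite_INT pattern_in_past simp: W_def\<close>)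
  have "prob (A j) = (q * (1 - q) ^ (2 * n + G * (n div 2) - 2)) ^ j" if "j \<le> Suc G" for j
    using that
  proof (induction j)
    case 0
    then show ?case by (simp add: A_def prob_space)
  next
    case (Suc j)
    have "A (Suc j) = A j \<inter> pattern j {y j} (W - {y j})"
      by (auto simp: A_def lessThan_Suc)
    moreover have "card (W - {y j}) = 2 * n + G * (n div 2) - 2"
      using y[of j] Suc.prems cardW by simp
    ultimately show ?case
      using Suc by (simp add: prob_past_pattern[OF A] W_def)
  qed
  moreover have "growth_event n G x = A (Suc G)"
    unfolding growth_event_eq[OF assms] A_def W_def y_def lessThan_Suc_atMost
    by (auto simp: pattern_def)
  ultimately show ?thesis by simp
qed

text \<open>
  Disjoint windows involve disjoint parts of the field, so the growth events are independent.
\<close>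

lemma prob_no_growth_event:
  assumes "n \<ge> 2" and disj: "\<And>i j. i < I \<Longrightarrow> j < I \<Longrightarrow> i \<noteq> j \<Longrightarrow>
    growth_window n G (x i) \<inter> growth_window n G (x j) = {}"
  shows "prob {\<omega> \<in> space M. \<forall>i<I. \<omega> \<notin> growth_event n G (x i)} =
    (1 - (q * (1 - q) ^ (2 * n + G * (n div 2) - 2)) ^ Suc G) ^ I"
proof (cases "I = 0")
  case True
  then show ?thesis by (simp add: prob_space)
next
  case False
  define K where "K i = {..G} \<times> growth_window n G (x i)" for i
  have "disjoint_family_on K {..<I}"
    using disj unfolding disjoint_family_on_def K_def by fastforce
  note ind = ring_algebras_indep[OF this]
  have ev: "growth_event n G (x i) \<in> events" for i
    using growth_event_past[OF assms(1)] past_events by blast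
  have "{\<omega> \<in> space M. \<forall>i<I. \<omega> \<notin> growth_event n G (x i)} =
      (\<Inter>i\<in>{..<I}. space M - growth_event n G (x i))"
    using False by auto
  also have "prob \<dots> = (\<Prod>i\<in>{..<I}. prob (space M - growth_event n G (x i)))"
  proof (rule indep_setsD[OF ind])
    show "\<forall>i\<in>{..<I}. space M - growth_event n G (x i) \<in> sets (ring_algebra M R (K i))"
      using growth_event_in_ring_algebra[OF assms(1)] sets.compl_sets[of _ "ring_algebra M R _"]
      by (simp add: K_def)
  qed (use False in auto)
  also have "\<dots> = (\<Prod>i\<in>{..<I}. 1 - (q * (1 - q) ^ (2 * n + G * (n div 2) - 2)) ^ Suc G)"
    by (intro prod.cong refl) (simp add: prob_compl[OF ev] prob_growth_event[OF assms(1)])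
  finally show ?thesis by simp
qed

end

section \<open>Poisson clocks as a field of rings\<close>

text \<open>
  If the count increases between \<open>s\<close> and \<open>t\<close>, the infimum of the times at which it exceeds its value at \<open>s\<close>
  is an arrival time, by right continuity.
\<close>

lemma arrival_in_interval_iff:
  fixes c :: "real \<Rightarrow> nat"
  assumes mono: "mono_on {0..} c" and right: "\<forall>t\<ge>0. eventually (\<lambda>s. c s = c t) (at_right t)"
    and st: "0 \<le> s" "s \<le> t"
  shows "(\<exists>u. s < u \<and> u \<le> t \<and> u \<in> arrival_times c) \<longleftrightarrow> c s < c t"
proof
  assume "\<exists>u. s < u \<and> u \<le> t \<and> u \<in> arrival_times c"
  then obtain u where "s < u" "u \<le> t" "u \<in> arrival_times c" by blast
  then have "c s < c u" using st by (auto simp: arrival_times_def)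
  also have "c u \<le> c t" using mono \<open>s < u\<close> \<open>u \<le> t\<close> st by (auto simp: mono_on_def)
  finally show "c s < c t" .
next
  assume less: "c s < c t"
  define B where "B = {v. s \<le> v \<and> v \<le> t \<and> c s < c v}"
  have "t \<in> B" using less st by (simp add: B_def)
  have bdd: "bdd_below B" by (rule bdd_belowI[of _ s]) (simp add: B_def)
  define u where "u = Inf B"
  have "u \<le> t" unfolding u_def using \<open>t \<in> B\<close> bdd by (rule cInf_lower)
  have "s \<le> u" unfolding u_def using \<open>t \<in> B\<close> by (intro cInf_greatest) (auto simp: B_def)
  have "c s < c u"
  proof (rule ccontr)
    assume not: "\<not> c s < c u"
    have "eventually (\<lambda>v. c v = c u) (at_right u)"
      using right \<open>0 \<le> s\<close> \<open>s \<le> u\<close> by auto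
    then obtain w where w: "u < w" "\<And>v. u < v \<Longrightarrow> v < w \<Longrightarrow> c v = c u"
      unfolding eventually_at_right_field by blast
    have "w \<le> Inf B"
    proof (rule cInf_greatest)
      show "B \<noteq> {}" using \<open>t \<in> B\<close> by blast
      fix v assume v: "v \<in> B"
      then have "u \<le> v" unfolding u_def using bdd by (rule cInf_lower)
      moreover have "c v \<noteq> c u" using v not by (auto simp: B_def)
      ultimately show "w \<le> v" using w(2)[of v] by (cases "v = u"; cases "v < w") auto
    qed
    then show False using w(1) by (simp add: u_def)
  qed
  then have "s \<noteq> u" by auto
  then have "s < u" using \<open>s \<le> u\<close> by simp
  have "u \<in> arrival_times c"
    unfolding arrival_times_def
  proof (intro CollectI conjI allI impI)
    show "0 < u" using \<open>0 \<le> s\<close> \<open>s < u\<close> by simp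
    fix v assume v: "0 \<le> v \<and> v < u"
    have "c v \<le> c s"
    proof (cases "v \<le> s")
      case True
      then show ?thesis using mono v by (auto simp: mono_on_def)
    next
      case False
      show ?thesis
      proof (rule ccontr)
        assume "\<not> c v \<le> c s"
        then have "v \<in> B" using False v \<open>u \<le> t\<close> by (simp add: B_def)
        then have "u \<le> v" unfolding u_def using bdd by (rule cInf_lower)
        then show False using v by simp
      qed
    qed
    then show "c v < c u" using \<open>c s < c u\<close> by simp
  qed
  with \<open>s < u\<close> \<open>u \<le> t\<close> show "\<exists>u. s < u \<and> u \<le> t \<and> u \<in> arrival_times c" by blast
qed

definition clock_rings :: "(int \<Rightarrow> real \<Rightarrow> 'w \<Rightarrow> nat) \<Rightarrow> real \<Rightarrow> nat \<Rightarrow> 'w \<Rightarrow> int set" where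
  "clock_rings N d k \<omega> = {y. N y (real k * d) \<omega> < N y (real (Suc k) * d) \<omega>}"

context majority_rule_process
begin

lemma AE_rung_eq_clock_rings:
  assumes "0 < d"
  shows "AE \<omega> in M. \<forall>k. rung (\<lambda>x. arrival_times (\<lambda>t. N x t \<omega>)) (real k * d) (real (Suc k) * d) =
    clock_rings N d k \<omega>"
proof -
  have "AE \<omega> in M. mono_on {0..} (\<lambda>t. N x t \<omega>)" for x
    using clocks_poisson[of x] by (rule poisson_process.count_mono)
  moreover have "AE \<omega> in M. \<forall>t\<ge>0. eventually (\<lambda>s. N x s \<omega> = N x t \<omega>) (at_right t)" for x
    using clocks_poisson[of x] by (rule poisson_process.count_right_continuous)
  ultimately have "AE \<omega> in M. \<forall>x. mono_on {0..} (\<lambda>t. N x t \<omega>) \<and>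
      (\<forall>t\<ge>0. eventually (\<lambda>s. N x s \<omega> = N x t \<omega>) (at_right t))"
    by (simp add: AE_all_countable)
  then show ?thesis
  proof eventually_elim
    case (elim \<omega>)
    show ?case
    proof (intro allI set_eqI)
      fix k x
      show "x \<in> rung (\<lambda>x. arrival_times (\<lambda>t. N x t \<omega>)) (real k * d) (real (Suc k) * d) \<longleftrightarrow>
          x \<in> clock_rings N d k \<omega>"
        unfolding rung_def clock_rings_def mem_Collect_eq
        using elim assms by (intro arrival_in_interval_iff) auto
    qed
  qed
qed

lemma clock_ring_probability:
  assumes "0 < d"
  shows "prob {\<omega> \<in> space M. y \<in> clock_rings N d k \<omega>} = 1 - exp (- d)"
proof -
  interpret clock: poisson_process M 1 "N y" by (rule clocks_poisson)
  have [measurable]: "N y (real k * d) \<in> measurable M (count_space UNIV)"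
    "N y (real (Suc k) * d) \<in> measurable M (count_space UNIV)"
    using assms by (intro clock.measurable_count; simp)+
  define X where "X \<omega> = N y (real (Suc k) * d) \<omega> - N y (real k * d) \<omega>" for \<omega>
  have [measurable]: "X \<in> measurable M (count_space UNIV)" unfolding X_def by measurable
  have "distr M (count_space UNIV) X = measure_pmf (poisson_pmf (1 * (real (Suc k) * d - real k * d)))"
    unfolding X_def using assms by (intro clock.increments_poisson) (simp_all add: algebra_simps)
  also have "1 * (real (Suc k) * d - real k * d) = d" by (simp add: algebra_simps)
  finally have "measure (distr M (count_space UNIV) X) {0} = measure_pmf.prob (poisson_pmf d) {0}"
    by simp
  then have "prob (X -` {0} \<inter> space M) = exp (- d)"
    using assms by (simp add: measure_distr measure_pmf_single)
  moreover have "{\<omega> \<in> space M. y \<in> clock_rings N d k \<omega>} = space M - (X -` {0} \<inter> space M)"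
    by (auto simp: clock_rings_def X_def)
  moreover have "X -` {0} \<inter> space M \<in> events" by measurable
  ultimately show ?thesis by (simp add: prob_compl)
qed

lemma ring_event_clock_rings: "ring_event M (clock_rings N d) (k, y) = {\<omega> \<in> space M. y \<in> clock_rings N d k \<omega>}"
  by (simp add: ring_event_def)

text \<open>
  Independence over the steps at one site comes from independent increments. Independence over
  the sites comes from independence of the clocks and is added in the next lemma.
\<close>

lemma prob_clock_rings_one_site:
  assumes "0 < d" "finite K" "K \<noteq> {}"
  shows "prob (\<Inter>k\<in>K. ring_event M (clock_rings N d) (k, y)) =
    (\<Prod>k\<in>K. prob (ring_event M (clock_rings N d) (k, y)))"
proof -
  interpret clock: poisson_process M 1 "N y" by (rule clocks_poisson)
  define t where "t i = real i * d" for i :: nat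
  define X where "X i \<omega> = N y (t (Suc i)) \<omega> - N y (t i) \<omega>" for i \<omega>
  have "indep_vars (\<lambda>_. count_space UNIV) X UNIV"
    unfolding X_def using assms(1)
    by (intro clock.increments_indep) (auto simp: t_def mono_def intro!: mult_right_mono)
  then have "indep_vars (\<lambda>_. count_space UNIV) X K"
    by (rule indep_vars_subset) simp
  then have ind: "prob (\<Inter>k\<in>K. X k -` {1..} \<inter> space M) = (\<Prod>k\<in>K. prob (X k -` {1..} \<inter> space M))"
    using assms(2,3) by (intro indep_varsD_finite) auto
  have "X k -` {1..} \<inter> space M = ring_event M (clock_rings N d) (k, y)" for k
    by (auto simp: X_def t_def ring_event_def clock_rings_def)
  then show ?thesis using ind by (simp only:)
qed

lemma ring_field_clock_rings:
  assumes "0 < d"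
  shows "ring_field M (clock_rings N d) (1 - exp (- d))"
proof
  let ?E = "ring_event M (clock_rings N d)"
  show "prob (?E (k, y)) = 1 - exp (- d)" for k y
    unfolding ring_event_clock_rings by (rule clock_ring_probability[OF assms])
  have path_rv: "(\<lambda>\<omega>. \<lambda>t\<in>{0..}. N y t \<omega>) \<in> measurable M (PiM {0..} (\<lambda>_. count_space UNIV))" for y
    using clocks_indep by (simp add: indep_vars_def)
  have component: "(\<lambda>f. f (real k * d)) \<in>
      borel_measurable (PiM {0..} (\<lambda>_. count_space UNIV :: nat measure))" for k :: nat
    using assms by (intro measurable_compose[OF measurable_component_singleton, of _ "{0..}"]) auto
  define B where "B k = {f \<in> space (PiM {0..} (\<lambda>_. count_space UNIV :: nat measure)).
    f (real k * d) < f (real (Suc k) * d)}" for k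
  have B: "B k \<in> sets (PiM {0..} (\<lambda>_. count_space UNIV :: nat measure))" for k
  proof -
    note component[of k, measurable] component[of "Suc k", measurable]
    show ?thesis unfolding B_def by measurable
  qed
  have E: "?E (k, y) = (\<lambda>\<omega>. \<lambda>t\<in>{0..}. N y t \<omega>) -` B k \<inter> space M" for k y
    using assms by (auto simp: ring_event_def clock_rings_def B_def space_PiM)
  have ev: "?E (k, y) \<in> events" for k y
    unfolding E by (rule measurable_sets[OF path_rv B])
  show "indep_events ?E UNIV"
  proof (rule indep_eventsI)
    show "?E i \<in> events" for i using ev by (cases i) simp
    fix J :: "(nat \<times> int) set" assume J: "finite J" "J \<noteq> {}"
    define Y where "Y = snd ` J"
    define K where "K y = {k. (k, y) \<in> J}" for y
    have Y: "finite Y" "Y \<noteq> {}" using J by (simp_all add: Y_def)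
    have K: "finite (K y)" for y
    proof -
      have "K y \<subseteq> fst ` J" by (force simp: K_def)
      then show ?thesis using J(1) finite_surj by blast
    qed
    have K_ne: "K y \<noteq> {}" if "y \<in> Y" for y using that by (auto simp: Y_def K_def)
    have J_eq: "J = prod.swap ` (SIGMA y:Y. K y)"
    proof (intro equalityI subsetI)
      fix i assume "i \<in> J"
      then have "(snd i, fst i) \<in> (SIGMA y:Y. K y)" by (auto simp: Y_def K_def)
      then show "i \<in> prod.swap ` (SIGMA y:Y. K y)" by (intro image_eqI[of _ _ "(snd i, fst i)"]) auto
    qed (auto simp: K_def)
    have path_event: "(\<lambda>\<omega>. \<lambda>t\<in>{0..}. N y t \<omega>) -` (\<Inter>k\<in>K y. B k) \<inter> space M = (\<Inter>k\<in>K y. ?E (k, y))"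
      if "y \<in> Y" for y
      using K_ne[OF that] by (auto simp: E)
    have "(\<Inter>i\<in>J. ?E i) = (\<Inter>y\<in>Y. \<Inter>k\<in>K y. ?E (k, y))"
      by (subst J_eq) auto
    also have "\<dots> = (\<Inter>y\<in>Y. (\<lambda>\<omega>. \<lambda>t\<in>{0..}. N y t \<omega>) -` (\<Inter>k\<in>K y. B k) \<inter> space M)"
      using path_event by (intro INF_cong) auto
    also have "prob \<dots> = (\<Prod>y\<in>Y. prob ((\<lambda>\<omega>. \<lambda>t\<in>{0..}. N y t \<omega>) -` (\<Inter>k\<in>K y. B k) \<inter> space M))"
    proof (rule indep_varsD_finite)
      show "indep_vars (\<lambda>_. PiM {0..} (\<lambda>_. count_space UNIV)) (\<lambda>x \<omega>. \<lambda>t\<in>{0..}. N x t \<omega>) Y"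
        using clocks_indep by (rule indep_vars_subset) simp
      show "(\<Inter>k\<in>K y. B k) \<in> sets (PiM {0..} (\<lambda>_. count_space UNIV))" if "y \<in> Y" for y
        using K K_ne[OF that] B by (intro sets.finite_INT) auto
    qed (use Y in auto)
    also have "\<dots> = (\<Prod>y\<in>Y. prob (\<Inter>k\<in>K y. ?E (k, y)))"
      using path_event by (intro prod.cong) auto
    also have "\<dots> = (\<Prod>y\<in>Y. \<Prod>k\<in>K y. prob (?E (k, y)))"
      using K K_ne by (intro prod.cong refl prob_clock_rings_one_site assms) auto
    also have "\<dots> = (\<Prod>p\<in>(SIGMA y:Y. K y). prob (?E (prod.swap p)))"
      using Y K by (subst prod.Sigma) (auto simp: prod.case_distrib split_def prod.swap_def)
    also have "\<dots> = (\<Prod>i\<in>J. prob (?E i))"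
      by (subst J_eq, subst prod.reindex) (auto simp: o_def)
    finally show "prob (\<Inter>i\<in>J. ?E i) = (\<Prod>i\<in>J. prob (?E i))" .
  qed
qed

end

section \<open>Long intervals survive and reach every vertex\<close>

lemma growth_step:
  assumes path: "majority_rule_path n A \<xi>" and "0 \<le> s"
    and S: "finite S" "S \<subseteq> \<xi> s" and maj: "n \<le> 2 * card (S \<inter> hyperedge n y)"
    and S': "S \<union> hyperedge n y = {x..<x + int n + int g * int (n div 2)}" and "g \<le> G"
    and ring: "rung A s t \<inter> growth_window n G x = {y}"
  shows "{x..<x + int n + int g * int (n div 2)} \<subseteq> \<xi> t"
proof -
  have "y \<in> rung A s t" using ring by blast
  then obtain u where u: "s < u" "u \<le> t" "u \<in> A y" by (auto simp: rung_def)
  have gG: "int g * int (n div 2) \<le> int G * int (n div 2)"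
    using \<open>g \<le> G\<close> by (intro mult_right_mono) auto
  have "S \<union> hyperedge n y \<subseteq> \<xi> t"
  proof (rule ones_spread[OF path \<open>0 \<le> s\<close> S u maj])
    fix v w assume v: "s < v" "v \<le> t" "v \<in> A w" and meet: "hyperedge n w \<inter> (S \<union> hyperedge n y) \<noteq> {}"
    have "w \<in> rung A s t" using v by (auto simp: rung_def)
    moreover have "w \<in> growth_window n G x"
      using meet gG unfolding S' by (auto simp: hyperedge_def growth_window_def)
    ultimately show "w = y" using ring by blast
  qed
  then show ?thesis unfolding S' .
qed

lemma growth_fills:
  assumes path: "majority_rule_path n A \<xi>" and "n \<ge> 2" "even n" "0 < d"
    and maj: "n \<le> 2 * card (\<xi> 0 \<inter> hyperedge n x)"
    and ring: "\<And>g. g \<le> G \<Longrightarrow> rung A (real g * d) (real (Suc g) * d) \<inter> growth_window n G x =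
      {x + int g * int (n div 2)}"
    and "g \<le> G"
  shows "{x..<x + int n + int g * int (n div 2)} \<subseteq> \<xi> (real (Suc g) * d)"
  using \<open>g \<le> G\<close>
proof (induction g)
  case 0
  have "(\<xi> 0 \<inter> hyperedge n x) \<inter> hyperedge n x = \<xi> 0 \<inter> hyperedge n x" by blast
  moreover have "(\<xi> 0 \<inter> hyperedge n x) \<union> hyperedge n x = {x..<x + int n + int 0 * int (n div 2)}"
    by (auto simp: hyperedge_def)
  ultimately show ?case
    using maj ring[OF 0] by (intro growth_step[OF path, of 0 "\<xi> 0 \<inter> hyperedge n x" x]) auto
next
  case (Suc g)
  define m where "m = int (n div 2)"
  have m: "int n = 2 * m" "0 < m" using assms(2,3) by (auto simp: m_def)
  define y where "y = x + int (Suc g) * m"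
  define S where "S = {x..<x + int n + int g * m}"
  define p where "p = int g * m"
  have p: "0 \<le> p" using m by (simp add: p_def)
  have Sg: "int (Suc g) * m = int g * m + m" by (simp add: algebra_simps)
  then have y: "y = x + int g * m + m" by (simp add: y_def)
  have S: "S \<inter> hyperedge n y = {y..<y + m}" "S \<union> hyperedge n y = {x..<x + int n + int (Suc g) * m}"
    unfolding S_def hyperedge_def y Sg m(1) p_def[symmetric] using p m(2) by auto
  have "n \<le> 2 * card (S \<inter> hyperedge n y)"
    unfolding S using m by simp
  moreover have "S \<subseteq> \<xi> (real (Suc g) * d)"
    using Suc by (simp add: S_def m_def)
  ultimately show ?case
    using ring[OF Suc.prems] S(2) \<open>0 < d\<close> Suc.prems unfolding m_def
    by (intro growth_step[OF path, of _ S y]) (auto simp: S_def y_def m_def)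
qed

text \<open>
  As long as the two boundary walks stay \<open>4n\<close> apart, the interval between them is full of ones. The
  walks themselves are defined from the rings alone, without reference to the path.
\<close>

lemma interval_chain:
  fixes a b :: int
  assumes path: "majority_rule_path n A \<xi>" and "0 < d"
    and rung: "\<And>k. rung A (real k * d) (real (Suc k) * d) = S k"
    and right_free: "\<And>k b. \<exists>j\<ge>1. S k \<inter> crossing n (b - int n * int j) = {}"
    and left_free: "\<And>k b. \<exists>j\<ge>1. mirror_rings n (S k) \<inter> crossing n (b - int n * int j) = {}"
    and start: "{a..<b} \<subseteq> \<xi> (real s * d)"
    and long: "\<And>k. k \<le> K \<Longrightarrow> 4 * int n \<le> right_edge n (\<lambda>j. S (s + j)) b k - left_edge n (\<lambda>j. S (s + j)) a k"
  shows "{left_edge n (\<lambda>j. S (s + j)) a K..<right_edge n (\<lambda>j. S (s + j)) b K} \<subseteq> \<xi> (real (s + K) * d)"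
  using long
proof (induction K)
  case 0
  then show ?case using start by (simp add: left_edge_0)
next
  case (Suc k)
  define l r where "l = left_edge n (\<lambda>j. S (s + j)) a k" and "r = right_edge n (\<lambda>j. S (s + j)) b k"
  have "{l..<r} \<subseteq> \<xi> (real (s + k) * d)" unfolding l_def r_def using Suc by simp
  moreover have "real (s + k) * d \<le> real (Suc (s + k)) * d"
    using \<open>0 < d\<close> by (intro mult_right_mono) auto
  moreover have "4 * int n \<le> (r + right_move n (S (s + k)) r) - (l + left_move n (S (s + k)) l)"
    using Suc.prems[of "Suc k"] by (simp add: l_def r_def left_edge_Suc)
  ultimately have "{l + left_move n (S (s + k)) l..<r + right_move n (S (s + k)) r} \<subseteq>
      \<xi> (real (Suc (s + k)) * d)"
    using interval_step[OF path, where s = "real (s + k) * d" and t = "real (Suc (s + k)) * d"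
        and a = l and b = r]
      right_free left_free \<open>0 < d\<close> unfolding rung by simp
  then show ?case by (simp add: l_def r_def left_edge_Suc)
qed

lemma (in ring_field) measurable_left_edge_M:
  "(\<lambda>\<omega>. left_edge n (\<lambda>j. R (s + j) \<omega>) a k) \<in> measurable M (count_space UNIV)"
proof -
  interpret mirror: ring_field M "\<lambda>k \<omega>. mirror_rings n (R k \<omega>)" q
    by (rule mirror_ring_field)
  show ?thesis
    unfolding left_edge_def using mirror.measurable_right_edge_M[of n s "- a" k] by measurable
qed

lemma exists_separated:
  fixes X :: "int set"
  assumes "infinite X"
  shows "\<exists>x :: nat \<Rightarrow> int. (\<forall>i<I. x i \<in> X) \<and> (\<forall>i<I. \<forall>j<I. i \<noteq> j \<longrightarrow> L < \<bar>x i - x j\<bar>)"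
proof (induction I)
  case (Suc I)
  then obtain x :: "nat \<Rightarrow> int" where x: "\<forall>i<I. x i \<in> X" "\<forall>i<I. \<forall>j<I. i \<noteq> j \<longrightarrow> L < \<bar>x i - x j\<bar>"
    by blast
  have "finite (\<Union>i<I. {x i - L..x i + L})" by simp
  then have "infinite (X - (\<Union>i<I. {x i - L..x i + L}))" using assms by simp
  then have "X - (\<Union>i<I. {x i - L..x i + L}) \<noteq> {}" by (metis finite.emptyI)
  then obtain c where c: "c \<in> X" "c \<notin> (\<Union>i<I. {x i - L..x i + L})" by blast
  have far: "L < \<bar>c - x i\<bar>" if "i < I" for i
  proof -
    have "c \<notin> {x i - L..x i + L}" using c(2) that by blast
    then show ?thesis by auto
  qed
  show ?case
  proof (intro exI[of _ "x(I := c)"] conjI allI impI)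
    fix i assume "i < Suc I"
    then show "(x(I := c)) i \<in> X" using x(1) c(1) by (cases "i = I") auto
  next
    fix i j assume ij: "i < Suc I" "j < Suc I" "i \<noteq> j"
    then consider "i = I" "j < I" | "j = I" "i < I" | "i < I" "j < I" by linarith
    then show "L < \<bar>(x(I := c)) i - (x(I := c)) j\<bar>"
      using far[of i] far[of j] x(2) ij by cases (simp_all add: abs_minus_commute)
  qed
qed simp

context majority_rule_process
begin

text \<open>
  Almost surely, \<open>z\<close> has opinion \<open>0\<close> only if no growth event occurs, or if the interval produced by the first
  growth event fails: one of its boundaries recedes by \<open>D\<close> at some step, or has not passed \<open>z\<close> at the
  end. The two summands bound these alternatives. Splitting according to the first growth
  event avoids a factor \<open>I\<close> in the second one, so that \<open>D\<close> can be chosen before \<open>I\<close>. The choice of \<open>G\<close>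
  leaves a length of at least \<open>4n\<close> after both boundaries have lost \<open>D\<close>.
\<close>

lemma prob_zero_at_grid_time:
  fixes \<eta>\<^sub>0 :: config and d q \<theta> \<rho> B :: real and x :: "nat \<Rightarrow> int" and D G I K :: nat and z :: int
  defines "q \<equiv> 1 - exp (- d)" and "G \<equiv> 2 * D + 4 * n"
  assumes n: "n \<ge> 2" "even n" and "0 < d" and "0 \<le> \<theta>"
    and small: "exp (\<theta> * n) * (n * q) \<le> 1 / 2" "n * q < 1"
    and \<rho>: "step_factor n \<theta> q \<le> \<rho>" "0 \<le> \<rho>" "\<rho> < 1"
    and init: "AE \<omega> in M. \<eta> 0 \<omega> = \<eta>\<^sub>0"
    and maj: "\<And>i. i < I \<Longrightarrow> n \<le> 2 * card (\<eta>\<^sub>0 \<inter> hyperedge n (x i))"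
    and disj: "\<And>i j. i < I \<Longrightarrow> j < I \<Longrightarrow> i \<noteq> j \<Longrightarrow>
      growth_window n G (x i) \<inter> growth_window n G (x j) = {}"
    and B: "\<And>i. i < I \<Longrightarrow> real_of_int \<bar>z - x i\<bar> \<le> B"
  shows "prob {\<omega> \<in> space M. z \<notin> \<eta> (real (Suc G + K) * d) \<omega>} \<le>
    (1 - (q * (1 - q) ^ (2 * n + G * (n div 2) - 2)) ^ Suc G) ^ I +
    2 * (exp (- \<theta> * D) / (1 - \<rho>) + exp (\<theta> * B) * \<rho> ^ K)"
proof -
  interpret rf: ring_field M "clock_rings N d" q
    unfolding q_def by (rule ring_field_clock_rings[OF \<open>0 < d\<close>])
  interpret mirror: ring_field M "\<lambda>k \<omega>. mirror_rings n (clock_rings N d k \<omega>)" q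
    by (rule rf.mirror_ring_field)
  define R where "R = clock_rings N d"
  define m where "m = int (n div 2)"
  have m: "int n = 2 * m" "1 \<le> m" using n by (auto simp: m_def)
  define b where "b i = x i + int n + int G * m" for i
  define E where "E i = rf.growth_event n G (x i)" for i
  \<comment> \<open>the growth event at \<open>x i\<close> is the first to occur; these events are disjoint and depend only on the
    steps up to \<open>G\<close>\<close>
  define A where "A i = E i - (\<Union>j<i. E j)" for i
  define right where "right i k \<omega> = right_edge n (\<lambda>j. R (Suc G + j) \<omega>) (b i) k" for i k \<omega>
  define left where "left i k \<omega> = left_edge n (\<lambda>j. R (Suc G + j) \<omega>) (x i) k" for i k \<omega>
  \<comment> \<open>failure of the right and of the left boundary\<close>
  define F1 where "F1 i = A i \<inter> {\<omega> \<in> space M. (\<exists>k\<le>K. right i k \<omega> \<le> b i - int D) \<or> right i K \<omega> \<le> z}" for i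
  define F2 where "F2 i = A i \<inter> {\<omega> \<in> space M. (\<exists>k\<le>K. x i + int D \<le> left i k \<omega>) \<or> z < left i K \<omega>}" for i
  define Q where "Q = exp (- \<theta> * D) / (1 - \<rho>) + exp (\<theta> * B) * \<rho> ^ K"
  have E_past: "E i \<in> sets (past M R (Suc G))" for i
    unfolding E_def R_def by (rule rf.growth_event_past[OF n(1)])
  have A_past: "A i \<in> sets (past M R (Suc G))" for i
    unfolding A_def using E_past by (intro sets.Diff sets.finite_UN) auto
  have Aev [measurable]: "A i \<in> events" for i
    using A_past rf.past_events unfolding R_def by blast
  have Eev [measurable]: "E i \<in> events" for i
    using E_past rf.past_events unfolding R_def by blast
  have [measurable]: "right i k \<in> measurable M (count_space UNIV)" for i k
    unfolding right_def R_def by (rule rf.measurable_right_edge_M)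
  have [measurable]: "left i k \<in> measurable M (count_space UNIV)" for i k
    unfolding left_def R_def by (rule rf.measurable_left_edge_M)
  have [measurable]: "F1 i \<in> events" "F2 i \<in> events" for i
    unfolding F1_def F2_def by measurable
  define N0 where "N0 = {\<omega> \<in> space M. \<forall>i<I. \<omega> \<notin> E i}"
  have [measurable]: "N0 \<in> events"
  proof -
    have "N0 = space M - (\<Union>i<I. E i)" by (auto simp: N0_def)
    then show ?thesis by auto
  qed
  have prF1: "prob (F1 i) \<le> Q * prob (A i)" if "i < I" for i
  proof -
    have "real_of_int (z - b i) \<le> B"
    proof -
      have "0 \<le> int G * m" using m by simp
      then have "x i \<le> b i" using m unfolding b_def by linarith
      then have "z - b i \<le> \<bar>z - x i\<bar>" by linarith
      then show ?thesis using B[OF that] by linarith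
    qed
    from rf.prob_right_edge_bad[OF A_past[unfolded R_def] small(1) \<rho> \<open>0 \<le> \<theta>\<close> this, where d = "int D" and K = K]
    show ?thesis unfolding F1_def Q_def right_def R_def by simp
  qed
  have prF2: "prob (F2 i) \<le> Q * prob (A i)" if "i < I" for i
  proof -
    have "real_of_int (x i - z) \<le> B" using B[OF that] by linarith
    from rf.prob_left_edge_bad[OF A_past[unfolded R_def] small(1) \<rho> \<open>0 \<le> \<theta>\<close> this, where d = "int D" and K = K]
    show ?thesis unfolding F2_def Q_def left_def R_def by simp
  qed
  have sumA: "(\<Sum>i<I. prob (A i)) \<le> 1"
  proof -
    have "disjoint_family_on A {..<I}"
      unfolding disjoint_family_on_def
    proof (intro ballI impI)
      fix i j :: nat assume "i \<noteq> j"
      then show "A i \<inter> A j = {}" by (cases i j rule: linorder_cases) (auto simp: A_def)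
    qed
    then have "(\<Sum>i<I. prob (A i)) = prob (\<Union>i<I. A i)"
      by (intro finite_measure_finite_Union[symmetric]) auto
    then show ?thesis by simp
  qed
  have "prob {\<omega> \<in> space M. z \<notin> \<eta> (real (Suc G + K) * d) \<omega>} \<le> prob (N0 \<union> (\<Union>i<I. F1 i \<union> F2 i))"
  proof (rule finite_measure_mono_AE)
    have "AE \<omega> in M. \<forall>k b. \<exists>j\<ge>1. R k \<omega> \<inter> crossing n (b - int n * int j) = {}"
      unfolding R_def by (rule rf.AE_free_crossing[OF small(2)])
    moreover have "AE \<omega> in M. \<forall>k b. \<exists>j\<ge>1. mirror_rings n (R k \<omega>) \<inter> crossing n (b - int n * int j) = {}"
      unfolding R_def by (rule mirror.AE_free_crossing[OF small(2)])
    moreover have "AE \<omega> in M. \<forall>k. rung (\<lambda>x. arrival_times (\<lambda>t. N x t \<omega>)) (real k * d) (real (Suc k) * d) = R k \<omega>"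
      unfolding R_def by (rule AE_rung_eq_clock_rings[OF \<open>0 < d\<close>])
    ultimately show "AE \<omega> in M. \<omega> \<in> {\<omega> \<in> space M. z \<notin> \<eta> (real (Suc G + K) * d) \<omega>} \<longrightarrow>
        \<omega> \<in> N0 \<union> (\<Union>i<I. F1 i \<union> F2 i)"
      using dynamics init AE_space
    proof eventually_elim
      case (elim \<omega>)
      show ?case
      proof (rule impI, rule ccontr)
        assume bad: "\<omega> \<in> {\<omega> \<in> space M. z \<notin> \<eta> (real (Suc G + K) * d) \<omega>}"
        assume good: "\<omega> \<notin> N0 \<union> (\<Union>i<I. F1 i \<union> F2 i)"
        then obtain i0 where "i0 < I" "\<omega> \<in> E i0" using elim(6) by (auto simp: N0_def)
        define i where "i = (LEAST i. \<omega> \<in> E i)"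
        have i: "\<omega> \<in> E i" "i \<le> i0" unfolding i_def using \<open>\<omega> \<in> E i0\<close> by (auto intro: LeastI Least_le)
        have "\<omega> \<notin> E j" if "j < i" for j
          using that not_less_Least unfolding i_def by blast
        then have "\<omega> \<in> A i" using i by (auto simp: A_def)
        have "i < I" using i \<open>i0 < I\<close> by simp
        then have nF: "\<omega> \<notin> F1 i" "\<omega> \<notin> F2 i" using good by auto
        have r: "b i - int D < right i k \<omega>" "left i k \<omega> < x i + int D" if "k \<le> K" for k
          using nF \<open>\<omega> \<in> A i\<close> elim(6) that unfolding F1_def F2_def by force+
        have zK: "z < right i K \<omega>" "left i K \<omega> \<le> z"
          using nF \<open>\<omega> \<in> A i\<close> elim(6) unfolding F1_def F2_def by force+
        have start: "{x i..<b i} \<subseteq> \<eta> (real (Suc G) * d) \<omega>"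
          unfolding b_def m_def
        proof (rule growth_fills[OF elim(4) n \<open>0 < d\<close>])
          show "n \<le> 2 * card (\<eta> 0 \<omega> \<inter> hyperedge n (x i))"
            using maj[OF \<open>i < I\<close>] elim(5) by simp
          show "rung (\<lambda>x. arrival_times (\<lambda>t. N x t \<omega>)) (real g * d) (real (Suc g) * d) \<inter>
              growth_window n G (x i) = {x i + int g * int (n div 2)}" if "g \<le> G" for g
            using i(1) that elim(3) by (auto simp: E_def rf.growth_event_def R_def)
        qed simp
        have "{left i K \<omega>..<right i K \<omega>} \<subseteq> \<eta> (real (Suc G + K) * d) \<omega>"
          unfolding left_def right_def
        proof (rule interval_chain[OF elim(4) \<open>0 < d\<close>, where S = "\<lambda>k. R k \<omega>"])
          fix k assume "k \<le> K"
          have "int G * 1 \<le> int G * m" using m(2) by (intro mult_left_mono) auto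
          then have "int G \<le> b i - x i - int n" by (simp add: b_def)
          then have "4 * int n \<le> right i k \<omega> - left i k \<omega>"
            using r[OF \<open>k \<le> K\<close>] by (simp add: G_def)
          then show "4 * int n \<le> right_edge n (\<lambda>j. R (Suc G + j) \<omega>) (b i) k -
              left_edge n (\<lambda>j. R (Suc G + j) \<omega>) (x i) k"
            by (simp add: left_def right_def)
        qed (use elim start in blast)+
        then show False using bad zK by auto
      qed
    qed
  qed measurable
  also have "\<dots> \<le> prob N0 + prob (\<Union>i<I. F1 i \<union> F2 i)"
    by (rule measure_Un_le) measurable
  also have "prob (\<Union>i<I. F1 i \<union> F2 i) \<le> (\<Sum>i<I. prob (F1 i \<union> F2 i))"
    by (rule finite_measure_subadditive_finite) auto
  also have "\<dots> \<le> (\<Sum>i<I. 2 * Q * prob (A i))"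
  proof (rule sum_mono)
    fix i assume "i \<in> {..<I}"
    then have "prob (F1 i) + prob (F2 i) \<le> 2 * Q * prob (A i)"
      using prF1[of i] prF2[of i] by simp
    moreover have "prob (F1 i \<union> F2 i) \<le> prob (F1 i) + prob (F2 i)"
      by (rule measure_Un_le) measurable
    ultimately show "prob (F1 i \<union> F2 i) \<le> 2 * Q * prob (A i)" by linarith
  qed
  also have "\<dots> = 2 * Q * (\<Sum>i<I. prob (A i))" by (simp add: sum_distrib_left)
  also have "\<dots> \<le> 2 * Q * 1"
    using sumA \<rho> by (intro mult_left_mono) (auto simp: Q_def)
  also have "prob N0 = (1 - (q * (1 - q) ^ (2 * n + G * (n div 2) - 2)) ^ Suc G) ^ I"
    unfolding N0_def E_def by (rule rf.prob_no_growth_event[OF n(1) disj])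
  finally show ?thesis by (simp add: Q_def)
qed

end

text \<open>
  Every large time is a multiple of a step length in \<open>{q\<^sub>1 / 2..q\<^sub>1}\<close>. So all large times, not only those on
  one grid, are covered by the estimate at grid times.
\<close>

lemma exists_grid:
  fixes T :: nat and q\<^sub>1 t :: real
  assumes "0 < q\<^sub>1" and "real (Suc T) * q\<^sub>1 \<le> t"
  obtains K :: nat and d where "T \<le> K" "t = real K * d" "q\<^sub>1 / 2 \<le> d" "d \<le> q\<^sub>1"
proof -
  define K where "K = nat \<lceil>t / q\<^sub>1\<rceil>"
  have t: "real (Suc T) \<le> t / q\<^sub>1" using assms by (simp add: field_simps)
  have K: "t / q\<^sub>1 \<le> real K" "real K \<le> t / q\<^sub>1 + 1"
    using t unfolding K_def by linarith+
  have "0 < real K" using t K(1) by simp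
  have "T \<le> K" using t K(1) by linarith
  moreover have "t / real K \<le> q\<^sub>1" using K(1) \<open>0 < real K\<close> \<open>0 < q\<^sub>1\<close> by (simp add: field_simps)
  moreover have "q\<^sub>1 / 2 \<le> t / real K"
  proof -
    have "real K \<le> 2 * (t / q\<^sub>1)" using K(2) t by simp
    then show ?thesis using \<open>0 < real K\<close> \<open>0 < q\<^sub>1\<close> by (simp add: field_simps)
  qed
  moreover have "t = real K * (t / real K)" using \<open>0 < real K\<close> by simp
  ultimately show ?thesis using that by blast
qed

text \<open>
  The constants are chosen in the order \<open>\<theta>\<close>, \<open>q\<^sub>1\<close>, \<open>\<rho>\<close>, \<open>D\<close>, \<open>I\<close>, and finally the
  number of steps. A long interval has to be reliable before it is known how many attempts are needed
  to produce it, and the places of these attempts determine how long it takes to reach \<open>z\<close>.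
\<close>

lemma (in majority_rule_process) eventually_prob_zero_less:
  fixes z :: int and \<epsilon> :: real
  assumes n: "n \<ge> 2" "even n" and init: "AE \<omega> in M. \<eta> 0 \<omega> = \<eta>\<^sub>0"
    and inf: "infinite {x. n \<le> 2 * card (\<eta>\<^sub>0 \<inter> hyperedge n x)}" and "0 < \<epsilon>"
  shows "eventually (\<lambda>t. prob {\<omega> \<in> space M. z \<notin> \<eta> t \<omega>} < \<epsilon>) at_top"
proof -
  obtain \<theta> where \<theta>: "\<theta> > 0" "drift n \<theta> < 0" using drift_negative[OF n(2,1)] .
  obtain q\<^sub>1 :: real where q\<^sub>1: "0 < q\<^sub>1" "q\<^sub>1 < 1"
    and small: "\<forall>q\<in>{0..q\<^sub>1}. exp (\<theta> * n) * (n * q) \<le> 1 / 2 \<and> n * q < 1 \<and>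
      step_factor n \<theta> q \<le> 1 + q * drift n \<theta> / 4"
    using step_factor_contracts[OF n(1) \<theta>(2)] by blast
  define q\<^sub>0 where "q\<^sub>0 = 1 - exp (- (q\<^sub>1 / 2))"
  have "0 < q\<^sub>0" using q\<^sub>1 by (simp add: q\<^sub>0_def)
  \<comment> \<open>the maximum with \<open>1 / 2\<close> makes \<open>\<rho>\<close> positive\<close>
  define \<rho> where "\<rho> = max (1 / 2) (1 + q\<^sub>0 * drift n \<theta> / 4)"
  have "q\<^sub>0 * drift n \<theta> < 0" using \<open>0 < q\<^sub>0\<close> \<theta>(2) by (rule mult_pos_neg)
  then have \<rho>: "0 < \<rho>" "\<rho> < 1" by (auto simp: \<rho>_def)
  have "eventually (\<lambda>D. exp (- \<theta> * real D) / (1 - \<rho>) < \<epsilon> / 8) sequentially"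
  proof (rule order_tendstoD)
    have "(\<lambda>D. exp (- \<theta>) ^ D / (1 - \<rho>)) \<longlonglongrightarrow> 0 / (1 - \<rho>)"
      using \<theta> \<rho> by (intro tendsto_divide LIMSEQ_realpow_zero) auto
    then show "(\<lambda>D. exp (- \<theta> * real D) / (1 - \<rho>)) \<longlonglongrightarrow> 0"
      by (simp add: exp_of_nat2_mult[symmetric])
  qed (use \<open>0 < \<epsilon>\<close> in simp)
  then obtain D where D: "exp (- \<theta> * real D) / (1 - \<rho>) < \<epsilon> / 8"
    using eventually_happens by fastforce
  define G where "G = 2 * D + 4 * n"
  define w where "w = 2 * n + G * (n div 2) - 2"
  define p where "p = (q\<^sub>0 * (1 - q\<^sub>1) ^ w) ^ Suc G"
  have "0 < p" using \<open>0 < q\<^sub>0\<close> q\<^sub>1 unfolding p_def by (intro zero_less_power mult_pos_pos) auto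
  have "p \<le> 1"
    unfolding p_def using \<open>0 < q\<^sub>0\<close> q\<^sub>1
    by (intro power_le_one mult_le_one mult_nonneg_nonneg) (auto simp: q\<^sub>0_def)
  have "eventually (\<lambda>I. (1 - p) ^ I < \<epsilon> / 2) sequentially"
    by (rule order_tendstoD[OF LIMSEQ_realpow_zero]) (use \<open>0 < p\<close> \<open>p \<le> 1\<close> \<open>0 < \<epsilon>\<close> in auto)
  then obtain I where I: "(1 - p) ^ I < \<epsilon> / 2"
    using eventually_happens by fastforce
  obtain x :: "nat \<Rightarrow> int" where x: "\<forall>i<I. x i \<in> {x. n \<le> 2 * card (\<eta>\<^sub>0 \<inter> hyperedge n x)}"
    "\<forall>i<I. \<forall>j<I. i \<noteq> j \<longrightarrow> 2 * int n + int G * int (n div 2) < \<bar>x i - x j\<bar>"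
    using exists_separated[OF inf] by blast
  define B where "B = (\<Sum>i<I. real_of_int \<bar>z - x i\<bar>)"
  have B: "real_of_int \<bar>z - x i\<bar> \<le> B" if "i < I" for i
    unfolding B_def using that by (intro member_le_sum) auto
  have "eventually (\<lambda>K. exp (\<theta> * B) * \<rho> ^ K < \<epsilon> / 8) sequentially"
  proof (rule order_tendstoD)
    show "(\<lambda>K. exp (\<theta> * B) * \<rho> ^ K) \<longlonglongrightarrow> 0"
      using \<rho> by (intro tendsto_mult_right_zero LIMSEQ_realpow_zero) auto
  qed (use \<open>0 < \<epsilon>\<close> in simp)
  then obtain K\<^sub>0 where K\<^sub>0: "\<And>K. K \<ge> K\<^sub>0 \<Longrightarrow> exp (\<theta> * B) * \<rho> ^ K < \<epsilon> / 8"
    by (auto simp: eventually_sequentially)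
  have "prob {\<omega> \<in> space M. z \<notin> \<eta> t \<omega>} < \<epsilon>" if t: "t \<ge> real (Suc (Suc G + K\<^sub>0)) * q\<^sub>1" for t
  proof -
    obtain K' d where K': "Suc G + K\<^sub>0 \<le> K'" "t = real K' * d" and d: "q\<^sub>1 / 2 \<le> d" "d \<le> q\<^sub>1"
      using exists_grid[OF q\<^sub>1(1) t] .
    define K where "K = K' - Suc G"
    have K: "K' = Suc G + K" "K\<^sub>0 \<le> K" using K'(1) by (auto simp: K_def)
    define q where "q = 1 - exp (- d)"
    have "1 - d \<le> exp (- d)" using exp_ge_add_one_self[of "- d"] by simp
    then have q: "q\<^sub>0 \<le> q" "q \<le> q\<^sub>1" using d by (auto simp: q_def q\<^sub>0_def)
    have q_pos: "0 \<le> q" using q \<open>0 < q\<^sub>0\<close> by simp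
    have "q * drift n \<theta> \<le> q\<^sub>0 * drift n \<theta>"
      using q \<theta> by (intro mult_right_mono_neg) auto
    moreover have small_q: "exp (\<theta> * n) * (n * q) \<le> 1 / 2" "n * q < 1"
      "step_factor n \<theta> q \<le> 1 + q * drift n \<theta> / 4"
      using small q_pos q(2) by simp_all
    ultimately have step: "step_factor n \<theta> q \<le> \<rho>"
      by (simp add: \<rho>_def)
    define P where "P = (q * (1 - q) ^ w) ^ Suc G"
    have "p \<le> P"
      unfolding p_def P_def using q q_pos \<open>0 < q\<^sub>0\<close> q\<^sub>1
      by (intro power_mono mult_mono) auto
    have "P \<le> 1"
      unfolding P_def using q q_pos q\<^sub>1
      by (intro power_le_one mult_le_one mult_nonneg_nonneg) auto
    have bound: "prob {\<omega> \<in> space M. z \<notin> \<eta> t \<omega>} \<le> (1 - P) ^ I +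
        2 * (exp (- \<theta> * D) / (1 - \<rho>) + exp (\<theta> * B) * \<rho> ^ K)"
      unfolding K'(2) K(1) P_def w_def G_def q_def
    proof (rule prob_zero_at_grid_time[OF n _ _ _ _ _ _ _ init])
      show "growth_window n (2 * D + 4 * n) (x i) \<inter> growth_window n (2 * D + 4 * n) (x j) = {}"
        if "i < I" "j < I" "i \<noteq> j" for i j
      proof -
        have "2 * int n + int G * int (n div 2) < \<bar>x i - x j\<bar>" using x(2) that by blast
        then show ?thesis unfolding growth_window_def G_def[symmetric] by auto
      qed
    qed (use q\<^sub>1 d \<theta> \<rho> x(1) B step small_q in \<open>auto simp: q_def\<close>)
    have "(1 - P) ^ I \<le> (1 - p) ^ I"
      using \<open>p \<le> P\<close> \<open>P \<le> 1\<close> by (intro power_mono) auto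
    then have "prob {\<omega> \<in> space M. z \<notin> \<eta> t \<omega>} \<le> (1 - p) ^ I +
        2 * (exp (- \<theta> * D) / (1 - \<rho>) + exp (\<theta> * B) * \<rho> ^ K)"
      using bound by (rule order_trans[rotated, OF add_right_mono])
    also have "\<dots> < \<epsilon> / 2 + 2 * (\<epsilon> / 8 + \<epsilon> / 8)"
      using I D K\<^sub>0[OF K(2)] by (intro add_strict_mono mult_strict_left_mono) auto
    finally show ?thesis by simp
  qed
  then show ?thesis by (auto simp: eventually_at_top_linorder)
qed

theorem theorem2:
  fixes M :: "'w measure" and n :: nat and N :: "int \<Rightarrow> real \<Rightarrow> 'w \<Rightarrow> nat"
    and \<eta> :: "real \<Rightarrow> 'w \<Rightarrow> config" and \<eta>\<^sub>0 :: config
  assumes "n \<ge> 2" and "even n"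
    and "majority_rule_process M n N \<eta>"
    and "AE \<omega> in M. \<eta> 0 \<omega> = \<eta>\<^sub>0"
    and "infinite {x. real (card (\<eta>\<^sub>0 \<inter> hyperedge n x)) > real n / 2}"
  shows "\<forall>x. ((\<lambda>t. \<P>(\<omega> in M. x \<notin> \<eta> t \<omega>)) \<longlongrightarrow> 0) at_top"
proof
  fix z
  interpret majority_rule_process M n N \<eta> by fact
  have "{x. real (card (\<eta>\<^sub>0 \<inter> hyperedge n x)) > real n / 2} \<subseteq>
      {x. n \<le> 2 * card (\<eta>\<^sub>0 \<inter> hyperedge n x)}"
    by auto
  then have inf: "infinite {x. n \<le> 2 * card (\<eta>\<^sub>0 \<inter> hyperedge n x)}"
    using assms(5) infinite_super by blast
  show "((\<lambda>t. \<P>(\<omega> in M. z \<notin> \<eta> t \<omega>)) \<longlongrightarrow> 0) at_top"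
  proof (rule order_tendstoI)
    fix a :: real assume "a < 0"
    then show "eventually (\<lambda>t. a < \<P>(\<omega> in M. z \<notin> \<eta> t \<omega>)) at_top"
      by (intro always_eventually allI) (meson measure_nonneg less_le_trans)
  next
    fix a :: real assume "0 < a"
    then show "eventually (\<lambda>t. \<P>(\<omega> in M. z \<notin> \<eta> t \<omega>) < a) at_top"
      by (rule eventually_prob_zero_less[OF assms(1,2,4) inf])
  qed
qed

end
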